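(* Let $0<p<1$, let $I\subset\mathbb{R}$ be a bounded open interval, and let $f$ be a $C^1$ homeomorphism of $I$ with $f'(x)\neq 0$ for all $x\in I$, such that $f'\in L^r(I)$ and $(f^{-1})'\in L^r(I)$ for some $r>1$. If $F\in L^p(I)$, then $$(f,F)\in\mathcal{M}^{1,p}(I)\quad\text{if and only if}\quad 0\leq \frac{F}{f'}\leq 1 \ \text{ almost everywhere in } I.$$ In particular, if $(f,F)\in\mathcal{M}^{1,p}(I)$, then $F\in L^r(I)$ and $(f,F)\in\mathcal{M}^{1,q}(I)$ for all $0<q<1$.
   Context: For a bounded open interval $I$, a $C^1$ homeomorphism of $I$ is a homeomorphism from $I$ onto $I$ that is of class $C^1$ on $I$. For $0<p<1$, $L^p(I)$ is the space of (classes of) measurable functions $f: I\to\mathbb{R}$ with $\|f\|_p=\left(\int_I|f|^p\right)^{1/p}<\infty$, with convergence in the quasi-norm $\|\cdot\|_p$. For $0<p<1$, $\mathcal{M}^{1,p}(I)$ denotes the set of pairs $(f,F)\in L^p(I)\times L^p(I)$ for which there exists a sequence $(f_n)_n$ of $C^1$ homeomorphisms of $I$ converging uniformly to $f$ and such that $(f_n')_n$ converges to $F$ in $L^p(I)$. *)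

theory Defs
  imports "HOL-Analysis.Analysis"
begin

text \<open>Elements of \<open>L\<^sup>p(I)\<close> are represented by functions on the real line; only their values on \<open>I\<close>,
  up to Lebesgue null sets, matter. The exponent is meant to be any positive real.\<close>

definition Lp :: "real \<Rightarrow> real set \<Rightarrow> (real \<Rightarrow> real) set" where
  "Lp p I = {f. f \<in> borel_measurable (lebesgue_on I)
              \<and> integrable (lebesgue_on I) (\<lambda>x. \<bar>f x\<bar> powr p)}"

definition Lp_norm :: "real \<Rightarrow> real set \<Rightarrow> (real \<Rightarrow> real) \<Rightarrow> real" where
  "Lp_norm p I f = (\<integral>x. \<bar>f x\<bar> powr p \<partial>lebesgue_on I) powr (1 / p)"

text \<open>Membership in \<open>Lp\<close> is required explicitly because the Bochner integral of a
  non-integrable function is 0.\<close>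

definition Lp_converges :: "real \<Rightarrow> real set \<Rightarrow> (nat \<Rightarrow> real \<Rightarrow> real) \<Rightarrow> (real \<Rightarrow> real) \<Rightarrow> bool" where
  "Lp_converges p I u v \<longleftrightarrow>
     (\<forall>n. u n \<in> Lp p I) \<and> v \<in> Lp p I \<and> (\<lambda>n. Lp_norm p I (\<lambda>x. u n x - v x)) \<longlonglongrightarrow> 0"

definition C1_homeomorphism :: "real set \<Rightarrow> (real \<Rightarrow> real) \<Rightarrow> bool" where
  "C1_homeomorphism I f \<longleftrightarrow> (\<exists>g. homeomorphism I I f g) \<and> f C1_differentiable_on I"

text \<open>The first component is a class of functions as well, so the uniform limit \<open>g\<close> is only required
  to be a representative of the class of \<open>f\<close>. If \<open>f\<close> is continuous on an open interval \<open>I\<close>, then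
  \<open>g = f\<close> on \<open>I\<close>.\<close>

definition M1p :: "real \<Rightarrow> real set \<Rightarrow> ((real \<Rightarrow> real) \<times> (real \<Rightarrow> real)) set" where
  "M1p p I = {(f, F). f \<in> Lp p I \<and> F \<in> Lp p I \<and>
     (\<exists>fn g. (\<forall>n. C1_homeomorphism I (fn n))
           \<and> (AE x in lebesgue_on I. g x = f x)
           \<and> uniform_limit I fn g sequentially
           \<and> Lp_converges p I (\<lambda>n. deriv (fn n)) F)}"

end

theory Submission
  imports Defs
begin

text \<open>Reflecting values, that is, passing from \<open>(f, F)\<close> to \<open>(a + b - f, -F)\<close>, reduces everything to
  increasing \<open>f\<close>, where the condition reads \<open>0 \<le> F \<le> f'\<close> almost everywhere.

  Necessity. The approximating homeomorphisms \<open>f\<^sub>n\<close> are eventually increasing, so \<open>F \<ge> 0\<close>. By Fatou's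
  lemma, the integral of \<open>F\<close> over an interval is at most the limit of the increments of \<open>f\<^sub>n\<close>, which is
  the increment of \<open>f\<close>, the integral of \<open>f'\<close>. Inequality of the integrals over all intervals implies
  \<open>F \<le> f'\<close> almost everywhere (\<open>AE_le_of_interval_integrals_le\<close>, \<open>M1p_imp_AE_between\<close>).

  Sufficiency. For \<open>q < 1\<close> a given amount of mass costs arbitrarily little in \<open>L\<^sup>q\<close> when it is squeezed
  into a set of small measure (\<open>integral_powr_le_small_support\<close>). First approximate \<open>F\<close> by a continuous
  density \<open>\<phi>\<close> with \<open>0 < \<phi> \<le> f'\<close> (\<open>exists_continuous_density\<close>). Let \<open>\<Phi>\<close> be its primitive and
  \<open>R = f - \<Phi>\<close>, the primitive of the excess \<open>f' - \<phi> \<ge> 0\<close>. Composing \<open>R\<close> with a staircase \<open>w\<close> of class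
  \<open>C\<^sup>1\<close>, close to the identity but flat off a small set (\<open>exists_staircase\<close>), moves the excess mass into
  that small set: \<open>\<Phi> + R \<circ> w\<close> is a \<open>C\<^sup>1\<close> homeomorphism uniformly close to \<open>f\<close> whose derivative is close
  to \<open>\<phi>\<close> in \<open>L\<^sup>q\<close> (\<open>exists_C1_homeomorphism_derivative_near\<close>).

  The remaining claims follow since \<open>0 \<le> F \<le> f'\<close> is independent of the exponent and \<open>f' \<in> L\<^sup>r\<close>.\<close>

section \<open>Comparing densities through their integrals over intervals\<close>

text \<open>This is a one-sided substitute for Lebesgue differentiation. Cover the set \<open>E\<close> where \<open>v < u\<close> by
  countably many non-overlapping intervals with total length at most \<open>|E| + e\<close>. Summing the
  hypothesis over the cover gives \<open>\<integral>\<^sub>E u \<le> \<integral>\<^sub>E v + M e\<close>, because the part of the cover outside \<open>E\<close> has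
  length at most \<open>e\<close> and \<open>v \<le> M\<close> there. Letting \<open>e\<close> tend to \<open>0\<close> contradicts \<open>v < u\<close> on \<open>E\<close> unless
  \<open>E\<close> is null.\<close>

lemma AE_le_of_interval_integrals_le:
  fixes u v :: "real \<Rightarrow> ennreal"
  assumes u: "u \<in> borel_measurable lebesgue" and v: "v \<in> borel_measurable lebesgue"
    and bound: "\<And>x. x \<in> {c..d} \<Longrightarrow> v x \<le> ennreal M"
    and le: "\<And>s t. c \<le> s \<Longrightarrow> s \<le> t \<Longrightarrow> t \<le> d \<Longrightarrow>
       (\<integral>\<^sup>+x. u x * indicator {s..t} x \<partial>lebesgue) \<le> (\<integral>\<^sup>+x. v x * indicator {s..t} x \<partial>lebesgue)"
  shows "AE x in lebesgue. x \<in> {c..d} \<longrightarrow> u x \<le> v x"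
proof -
  note [measurable] = u v
  define E where "E = {x\<in>{c..d}. v x < u x}"
  define U where "U = density lebesgue u"
  define V where "V = density lebesgue v"
  have EL[measurable]: "E \<in> sets lebesgue"
  proof -
    have "{x \<in> space lebesgue. v x < u x} \<in> sets lebesgue" by measurable
    moreover have "{c..d} \<in> sets lebesgue" by simp
    ultimately have "{c..d} \<inter> {x \<in> space lebesgue. v x < u x} \<in> sets lebesgue"
      by (rule sets.Int[rotated])
    moreover have "{c..d} \<inter> {x \<in> space lebesgue. v x < u x} = E" by (auto simp: E_def)
    ultimately show ?thesis by simp
  qed
  have Efin: "E \<in> lmeasurable"
    by (rule fmeasurableI2[where A="{c..d}"]) (use EL in \<open>auto simp: E_def\<close>)
  have UE: "emeasure U E = (\<integral>\<^sup>+x. u x * indicator E x \<partial>lebesgue)"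
    unfolding U_def by (rule emeasure_density) measurable
  have VE: "emeasure V E = (\<integral>\<^sup>+x. v x * indicator E x \<partial>lebesgue)"
    unfolding V_def by (rule emeasure_density) measurable
  have Vle: "emeasure V A \<le> ennreal M * emeasure lebesgue A" if "A \<in> sets lebesgue" "A \<subseteq> {c..d}" for A
  proof -
    have "emeasure V A = (\<integral>\<^sup>+x. v x * indicator A x \<partial>lebesgue)"
      unfolding V_def using that by (intro emeasure_density) auto
    also have "\<dots> \<le> (\<integral>\<^sup>+x. ennreal M * indicator A x \<partial>lebesgue)"
      using that bound by (intro nn_integral_mono) (auto split: split_indicator)
    also have "\<dots> = ennreal M * emeasure lebesgue A"
      using that by (simp add: nn_integral_cmult_indicator)
    finally show ?thesis .
  qed
  have main: "emeasure U E \<le> emeasure V E + ennreal M * ennreal e" if "e > 0" for e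
  proof -
    \<comment> \<open>The intervals of \<open>D\<close> may share endpoints; their interiors are disjoint and miss only a null set.\<close>
    obtain D where cD: "countable D"
      and D1: "\<And>K. K \<in> D \<Longrightarrow> K \<subseteq> cbox c d \<and> K \<noteq> {} \<and> (\<exists>s t. K = cbox s t)"
      and D2: "pairwise (\<lambda>A B. interior A \<inter> interior B = {}) D"
      and D3: "E \<subseteq> \<Union>D" "\<Union>D \<in> lmeasurable" "measure lebesgue (\<Union>D) \<le> measure lebesgue E + e"
    proof (rule measurable_outer_intervals_bounded[OF Efin _ \<open>e > 0\<close>, of c d])
      show "E \<subseteq> cbox c d" by (auto simp: E_def)
    qed (assumption | rule that)+
    have shape: "\<exists>s t. c \<le> s \<and> s \<le> t \<and> t \<le> d \<and> K = {s..t}" if "K \<in> D" for K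
      using D1[OF that] by (auto simp: cbox_interval)
    define G where "G = (\<Union>K\<in>D. interior K)"
    have "open G" by (auto simp: G_def)
    then have Gm[measurable]: "G \<in> sets lebesgue"
      by (metis borel_open sets_completionI_sets sets_lborel)
    have neg: "negligible (\<Union>D - G)"
    proof (rule negligible_subset)
      show "negligible (\<Union>K\<in>D. K - interior K)"
      proof (rule negligible_countable_Union)
        show "countable ((\<lambda>K. K - interior K) ` D)" using cD by auto
        show "\<And>t. t \<in> (\<lambda>K. K - interior K) ` D \<Longrightarrow> negligible t"
        proof -
          fix t' assume "t' \<in> (\<lambda>K. K - interior K) ` D"
          then obtain K where "K \<in> D" "t' = K - interior K" by auto
          with shape obtain s t where "t' \<subseteq> {s, t}"  by (force simp: cbox_interval)
          then show "negligible t'"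
            by (meson finite.emptyI finite_insert negligible_finite negligible_subset)
        qed
      qed
    qed (auto simp: G_def)
    have null: "emeasure U (\<Union>D - G) = 0"
    proof -
      have "\<Union>D - G \<in> null_sets lebesgue" using neg negligible_iff_null_sets by blast
      moreover have "absolutely_continuous lebesgue U" unfolding U_def
        by (rule absolutely_continuousI_density) measurable
      ultimately show ?thesis unfolding absolutely_continuous_def by blast
    qed
    have DL: "\<Union>D \<in> sets lebesgue" using D3(2) by (simp add: fmeasurableD)
    have sU: "sets U = sets lebesgue" "sets V = sets lebesgue" by (simp_all add: U_def V_def)
    have disj: "disjoint_family_on interior D"
      using D2 unfolding disjoint_family_on_def pairwise_def by blast
    have "emeasure U E \<le> emeasure U (G \<union> (\<Union>D - G))"
      using D3(1) DL Gm EL sU by (intro emeasure_mono) auto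
    also have "\<dots> \<le> emeasure U G + emeasure U (\<Union>D - G)"
      using DL Gm sU by (intro emeasure_subadditive) auto
    also have "\<dots> = emeasure U G" using null by simp
    also have "\<dots> = (\<integral>\<^sup>+K. emeasure U (interior K) \<partial>count_space D)"
      unfolding G_def by (rule emeasure_UN_countable) (use cD disj sU in auto)
    also have "\<dots> \<le> (\<integral>\<^sup>+K. emeasure V (interior K) \<partial>count_space D)"
    proof (rule nn_integral_mono)
      fix K assume "K \<in> space (count_space D)"
      then obtain s t where st: "c \<le> s" "s \<le> t" "t \<le> d" "K = {s..t}" using shape[of K] by auto
      have n: "AE x in lebesgue. x \<noteq> s" "AE x in lebesgue. x \<noteq> t"
        by (auto simp: AE_completion_iff intro: AE_lborel_singleton AE_completion)
      have eq: "AE x in lebesgue. w x * indicator {s<..<t} x = w x * indicator {s..t} x" for w :: "real \<Rightarrow> ennreal"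
        using n by eventually_elim (auto split: split_indicator)
      have "emeasure U (interior K) = (\<integral>\<^sup>+x. u x * indicator {s<..<t} x \<partial>lebesgue)"
        unfolding U_def st by (simp add: emeasure_density)
      also have "\<dots> = (\<integral>\<^sup>+x. u x * indicator {s..t} x \<partial>lebesgue)"
        by (rule nn_integral_cong_AE) (rule eq)
      also have "\<dots> \<le> (\<integral>\<^sup>+x. v x * indicator {s..t} x \<partial>lebesgue)" using le st by blast
      also have "\<dots> = (\<integral>\<^sup>+x. v x * indicator {s<..<t} x \<partial>lebesgue)"
        by (rule nn_integral_cong_AE) (use eq[of v] in \<open>eventually_elim, simp\<close>)
      also have "\<dots> = emeasure V (interior K)"
        unfolding V_def st by (simp add: emeasure_density)
      finally show "emeasure U (interior K) \<le> emeasure V (interior K)" .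
    qed
    also have "\<dots> = emeasure V G"
      unfolding G_def by (rule emeasure_UN_countable[symmetric]) (use cD disj sU in auto)
    also have "\<dots> \<le> emeasure V (\<Union>D)"
    proof (rule emeasure_mono)
      show "G \<subseteq> \<Union>D" unfolding G_def using interior_subset by blast
    qed (use DL sU in auto)
    also have "\<dots> = emeasure V (E \<union> (\<Union>D - E))" using D3(1) by (simp add: Un_absorb1)
    also have "\<dots> \<le> emeasure V E + emeasure V (\<Union>D - E)"
      using DL EL sU by (intro emeasure_subadditive) auto
    also have "emeasure V (\<Union>D - E) \<le> ennreal M * emeasure lebesgue (\<Union>D - E)"
      using DL EL D1 by (intro Vle) auto
    also have "emeasure lebesgue (\<Union>D - E) \<le> ennreal e"
    proof -
      have "measure lebesgue (\<Union>D - E) = measure lebesgue (\<Union>D) - measure lebesgue E"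
        using D3 Efin by (intro measurable_measure_Diff) auto
      moreover have "\<Union>D - E \<in> lmeasurable" using D3 Efin by (intro fmeasurable.Diff) auto
      ultimately show ?thesis using D3(3)
        by (simp add: emeasure_eq_measure2 ennreal_leI)
    qed
    finally show ?thesis by (simp add: mult_left_mono)
  qed
  have "emeasure U E \<le> emeasure V E"
  proof (rule ennreal_le_epsilon)
    fix e :: real assume "e > 0"
    define e' where "e' = e / (\<bar>M\<bar> + 1)"
    have "e' > 0" using \<open>e > 0\<close> by (simp add: e'_def)
    have "ennreal M * ennreal e' \<le> ennreal (\<bar>M\<bar> + 1) * ennreal e'"
      by (intro mult_right_mono ennreal_leI) auto
    also have "\<dots> = ennreal e"
      using \<open>e > 0\<close> by (subst ennreal_mult[symmetric]) (auto simp: e'_def)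
    finally show "emeasure U E \<le> emeasure V E + ennreal e"
      using main[OF \<open>e' > 0\<close>] by (meson add_left_mono order_trans)
  qed
  moreover have "emeasure V E < \<infinity>"
  proof (rule le_less_trans)
    show "emeasure V E \<le> ennreal M * emeasure lebesgue E"
      by (rule Vle[OF EL]) (auto simp: E_def)
    show "ennreal M * emeasure lebesgue E < \<infinity>"
      using Efin by (simp only: fmeasurable_def ennreal_mult_less_top infinity_ennreal_def
          ennreal_less_top mem_Collect_eq) simp
  qed
  ultimately have le: "emeasure U E \<le> emeasure V E" and fin: "emeasure V E < \<infinity>" by auto
  have "(\<integral>\<^sup>+x. u x * indicator E x - v x * indicator E x \<partial>lebesgue)
      = (\<integral>\<^sup>+x. u x * indicator E x \<partial>lebesgue) - (\<integral>\<^sup>+x. v x * indicator E x \<partial>lebesgue)"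
  proof (rule nn_integral_diff)
    show "(\<integral>\<^sup>+x. v x * indicator E x \<partial>lebesgue) \<noteq> \<infinity>" using fin VE by simp
    show "AE x in lebesgue. v x * indicator E x \<le> u x * indicator E x"
      by (intro AE_I2) (simp add: E_def less_imp_le split: split_indicator)
  qed measurable
  also have "\<dots> = emeasure U E - emeasure V E" by (simp only: UE VE)
  also have "\<dots> = 0" using le fin by (intro diff_eq_0_ennreal) auto
  finally have "(\<integral>\<^sup>+x. u x * indicator E x - v x * indicator E x \<partial>lebesgue) = 0" .
  then have "AE x in lebesgue. u x * indicator E x - v x * indicator E x = 0"
    by (subst (asm) nn_integral_0_iff_AE) measurable
  then show ?thesis
  proof eventually_elim
    case (elim x)
    show ?case
    proof (rule impI, rule ccontr)
      assume "x \<in> {c..d}" "\<not> u x \<le> v x"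
      then have "x \<in> E" by (auto simp: E_def)
      with elim \<open>\<not> u x \<le> v x\<close> show False
        by (auto simp: diff_eq_0_iff_ennreal)
    qed
  qed
qed

section \<open>Homeomorphisms of class C1 and convergence in Lp\<close>

lemma
  assumes "C1_homeomorphism I f"
  shows C1_homeomorphism_continuous_on: "continuous_on I f"
    and C1_homeomorphism_image: "f ` I = I"
    and C1_homeomorphism_inj_on: "inj_on f I"
    and C1_homeomorphism_has_derivative: "\<And>x. x \<in> I \<Longrightarrow> (f has_real_derivative deriv f x) (at x)"
    and C1_homeomorphism_continuous_deriv: "continuous_on I (deriv f)"
proof -
  obtain g where g: "homeomorphism I I f g" and C1: "f C1_differentiable_on I"
    using assms by (auto simp: C1_homeomorphism_def)
  show "continuous_on I f" "f ` I = I" "inj_on f I"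
    using g by (auto simp: homeomorphism_def intro: inj_on_inverseI[of _ g])
  obtain D where D: "\<And>x. x \<in> I \<Longrightarrow> (f has_real_derivative D x) (at x)" "continuous_on I D"
    using C1 by (auto simp: C1_differentiable_on_def has_real_derivative_iff_has_vector_derivative)
  have eq: "deriv f x = D x" if "x \<in> I" for x using D(1)[OF that] by (rule DERIV_imp_deriv)
  show "\<And>x. x \<in> I \<Longrightarrow> (f has_real_derivative deriv f x) (at x)" using D(1) eq by simp
  show "continuous_on I (deriv f)" using D(2) eq by (simp cong: continuous_on_cong)
qed

lemma C1_homeomorphism_monotone:
  assumes "C1_homeomorphism {a<..<b} f"
  shows "strict_mono_on {a<..<b} f \<or> strict_antimono_on {a<..<b} f"
  using injective_eq_monotone_map[of "{a<..<b}" f] C1_homeomorphism_continuous_on[OF assms]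
    C1_homeomorphism_inj_on[OF assms] by (simp add: is_interval_oo)

lemma strict_mono_on_deriv_nonneg:
  fixes f :: "real \<Rightarrow> real"
  assumes mono: "strict_mono_on {a<..<b} f" and der: "(f has_real_derivative D) (at x)"
    and x: "x \<in> {a<..<b}"
  shows "0 \<le> D"
proof (rule ccontr)
  assume "\<not> 0 \<le> D"
  then obtain d where d: "d > 0" "\<And>h. h > 0 \<Longrightarrow> h < d \<Longrightarrow> f (x + h) < f x"
    using DERIV_neg_dec_right[OF der] by auto
  define h where "h = min d (b - x) / 2"
  have "h > 0" "h < d" "x + h < b" using d(1) x by (auto simp: h_def min_def field_simps)
  then have "f x < f (x + h)" using mono x by (auto simp: monotone_on_def)
  with d(2)[OF \<open>h > 0\<close> \<open>h < d\<close>] show False by simp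
qed

lemma nn_integral_deriv_strict_mono:
  fixes f :: "real \<Rightarrow> real"
  assumes f: "C1_homeomorphism {a<..<b} f" "strict_mono_on {a<..<b} f"
    and st: "a < s" "s \<le> t" "t < b"
  shows "(\<integral>\<^sup>+x. ennreal (deriv f x) * indicator {s..t} x \<partial>lebesgue) = ennreal (f t - f s)"
proof -
  have der: "(f has_real_derivative deriv f x) (at x)" if "x \<in> {s..t}" for x
    using C1_homeomorphism_has_derivative[OF f(1), of x] st that by auto
  have "(deriv f has_integral (f t - f s)) {s..t}"
    using st der by (intro fundamental_theorem_of_calculus)
      (auto simp: has_real_derivative_iff_has_vector_derivative[symmetric] intro: DERIV_subset)
  moreover have "0 \<le> deriv f x" if "x \<in> {s..t}" for x
    using strict_mono_on_deriv_nonneg[OF f(2) der[OF that]] st that by auto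
  ultimately show ?thesis
    by (subst nn_integral_completion) (rule nn_integral_has_integral_lebesgue', auto)
qed

text \<open>A quasi-triangle inequality that is valid for every positive exponent; the constant is not
  optimal, but only its finiteness matters for integrability and convergence.\<close>

lemma abs_diff_powr_le:
  fixes s t :: real
  assumes "p > 0"
  shows "\<bar>s - t\<bar> powr p \<le> 2 powr p * (\<bar>s\<bar> powr p + \<bar>t\<bar> powr p)"
proof -
  have "\<bar>s - t\<bar> powr p \<le> (2 * max \<bar>s\<bar> \<bar>t\<bar>) powr p"
    using assms by (intro powr_mono2) auto
  also have "\<dots> = 2 powr p * max \<bar>s\<bar> \<bar>t\<bar> powr p" by (subst powr_mult) auto
  also have "\<dots> \<le> 2 powr p * (\<bar>s\<bar> powr p + \<bar>t\<bar> powr p)"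
    by (intro mult_left_mono) (auto simp: max_def)
  finally show ?thesis .
qed

lemma Lp_diff:
  assumes "p > 0" "u \<in> Lp p I" "v \<in> Lp p I"
  shows "(\<lambda>x. u x - v x) \<in> Lp p I"
proof -
  have m[measurable]: "u \<in> borel_measurable (lebesgue_on I)" "v \<in> borel_measurable (lebesgue_on I)"
    and i: "integrable (lebesgue_on I) (\<lambda>x. \<bar>u x\<bar> powr p)" "integrable (lebesgue_on I) (\<lambda>x. \<bar>v x\<bar> powr p)"
    using assms by (auto simp: Lp_def)
  have "integrable (lebesgue_on I) (\<lambda>x. \<bar>u x - v x\<bar> powr p)"
  proof (rule Bochner_Integration.integrable_bound)
    show "integrable (lebesgue_on I) (\<lambda>x. 2 powr p * (\<bar>u x\<bar> powr p + \<bar>v x\<bar> powr p))"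
      using i by auto
    show "AE x in lebesgue_on I. norm (\<bar>u x - v x\<bar> powr p)
        \<le> norm (2 powr p * (\<bar>u x\<bar> powr p + \<bar>v x\<bar> powr p))"
      using abs_diff_powr_le[OF assms(1)] by (intro AE_I2) (simp add: abs_mult)
  qed measurable
  then show ?thesis by (auto simp: Lp_def)
qed

text \<open>Convergence in the quasi-norm is convergence to \<open>0\<close> in \<open>L\<^sup>1\<close> of \<open>|u\<^sub>n - v|\<^sup>p\<close>, so the known
  subsequence theorem for \<open>L\<^sup>1\<close> applies for \<open>p < 1\<close> as well.\<close>

lemma Lp_converges_AE_subseq:
  assumes p: "p > 0" and conv: "Lp_converges p I u v"
  obtains r :: "nat \<Rightarrow> nat" where "strict_mono r" "AE x in lebesgue_on I. (\<lambda>n. u (r n) x) \<longlonglongrightarrow> v x"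
proof -
  have L: "\<And>n. u n \<in> Lp p I" "v \<in> Lp p I"
    and lim: "(\<lambda>n. Lp_norm p I (\<lambda>x. u n x - v x)) \<longlonglongrightarrow> 0"
    using conv by (auto simp: Lp_converges_def)
  have int: "integrable (lebesgue_on I) (\<lambda>x. \<bar>u n x - v x\<bar> powr p)" for n
    using Lp_diff[OF p L(1)[of n] L(2)] by (simp add: Lp_def)
  have "(\<lambda>n. Lp_norm p I (\<lambda>x. u n x - v x) powr p) \<longlonglongrightarrow> 0"
    using lim p by (intro tendsto_zero_powrI[of _ _ _ p]) (auto simp: Lp_norm_def)
  moreover have "Lp_norm p I (\<lambda>x. u n x - v x) powr p = (\<integral>x. \<bar>u n x - v x\<bar> powr p \<partial>lebesgue_on I)" for n
    using p by (simp add: Lp_norm_def powr_powr)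
  ultimately have "(\<lambda>n. \<integral>x. norm (\<bar>u n x - v x\<bar> powr p) \<partial>lebesgue_on I) \<longlonglongrightarrow> 0" by simp
  from tendsto_L1_AE_subseq[OF int this] obtain r where r: "strict_mono r"
    and ae: "AE x in lebesgue_on I. (\<lambda>n. \<bar>u (r n) x - v x\<bar> powr p) \<longlonglongrightarrow> 0" by blast
  from ae have "AE x in lebesgue_on I. (\<lambda>n. u (r n) x) \<longlonglongrightarrow> v x"
  proof eventually_elim
    case (elim x)
    have "(\<lambda>n. (\<bar>u (r n) x - v x\<bar> powr p) powr (1/p)) \<longlonglongrightarrow> 0"
      using p by (intro tendsto_zero_powrI[OF elim tendsto_const]) auto
    then have "(\<lambda>n. \<bar>u (r n) x - v x\<bar>) \<longlonglongrightarrow> 0" using p by (simp add: powr_powr)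
    then show ?case by (simp add: tendsto_rabs_zero_iff LIM_zero_iff)
  qed
  with r that show ?thesis by blast
qed

text \<open>Two continuous functions differ on an open set, and a nonempty open set is never null. This
  identifies the uniform limit in the definition of \<open>M1p\<close> with \<open>f\<close> itself.\<close>

lemma AE_continuous_eq_on_open:
  fixes f g :: "real \<Rightarrow> real"
  assumes "open I" "continuous_on I f" "continuous_on I g"
    and ae: "AE x in lebesgue_on I. g x = f x" and "x \<in> I"
  shows "g x = f x"
proof -
  define S where "S = I \<inter> (\<lambda>x. g x - f x) -` (- {0})"
  have "open S" unfolding S_def
    using assms by (intro continuous_open_preimage continuous_on_diff) auto
  moreover have "negligible S"
  proof -
    have IL: "I \<in> sets lebesgue" using \<open>open I\<close> by (metis borel_open sets_completionI_sets sets_lborel)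
    have "AE x in lebesgue. x \<in> I \<longrightarrow> g x = f x" using ae IL by (simp add: AE_restrict_space_iff)
    then have "AE x in lebesgue. x \<notin> S" by eventually_elim (auto simp: S_def)
    moreover have "S \<in> sets lebesgue" using \<open>open S\<close> by (metis borel_open sets_completionI_sets sets_lborel)
    ultimately have "S \<in> null_sets lebesgue" by (simp only: AE_iff_null_sets)
    then show ?thesis by (simp add: negligible_iff_null_sets)
  qed
  ultimately have "S = {}" using open_not_negligible by blast
  then show ?thesis using \<open>x \<in> I\<close> by (auto simp: S_def)
qed

section \<open>Necessity: limits of derivatives lie between 0 and the derivative of the limit\<close>

text \<open>Along a subsequence the derivatives converge almost everywhere, so the limit \<open>F\<close> is nonnegative,
  and Fatou's lemma on \<open>{s..t}\<close> gives \<open>\<integral> F \<le> lim (f\<^sub>n t - f\<^sub>n s) = f t - f s = \<integral> f'\<close>: mass may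
  disappear in the limit but not be created. The comparison of densities turns this into
  \<open>F \<le> f'\<close>. It is applied on compact subintervals, where \<open>f'\<close> is bounded.\<close>

lemma M1p_imp_AE_between:
  fixes f F :: "real \<Rightarrow> real"
  assumes p: "0 < p" and ab: "a < b" and f: "C1_homeomorphism {a<..<b} f" "strict_mono_on {a<..<b} f"
    and M: "(f, F) \<in> M1p p {a<..<b}"
  shows "AE x in lebesgue_on {a<..<b}. 0 \<le> F x \<and> F x \<le> deriv f x"
proof -
  let ?I = "{a<..<b}"
  obtain fn g where fn: "\<And>n. C1_homeomorphism ?I (fn n)"
    and ae: "AE x in lebesgue_on ?I. g x = f x"
    and unif: "uniform_limit ?I fn g sequentially"
    and Lp: "Lp_converges p ?I (\<lambda>n. deriv (fn n)) F"
    using M by (auto simp: M1p_def)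
  have contg: "continuous_on ?I g"
    by (intro uniform_limit_theorem[OF _ unif] always_eventually allI
        C1_homeomorphism_continuous_on fn) simp
  have gf: "g x = f x" if "x \<in> ?I" for x
    by (rule AE_continuous_eq_on_open[OF _ C1_homeomorphism_continuous_on[OF f(1)] contg ae that]) simp
  have lim: "(\<lambda>n. fn n x) \<longlonglongrightarrow> f x" if "x \<in> ?I" for x
    using tendsto_uniform_limitI[OF unif that] gf[OF that] by simp
  \<comment> \<open>Comparing the values at two points shows that \<open>fn n\<close> is eventually increasing, like \<open>f\<close>.\<close>
  define x1 x2 where "x1 = (2 * a + b) / 3" and "x2 = (a + 2 * b) / 3"
  have x12: "x1 \<in> ?I" "x2 \<in> ?I" "x1 < x2" using ab by (auto simp: x1_def x2_def)
  have "f x1 < f x2" using f(2) x12 by (auto simp: monotone_on_def)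
  then have "(\<lambda>n. fn n x2 - fn n x1) \<longlonglongrightarrow> f x2 - f x1" "0 < f x2 - f x1"
    using lim x12 by (auto intro: tendsto_diff)
  then have "\<forall>\<^sub>F n in sequentially. 0 < fn n x2 - fn n x1" by (rule order_tendstoD)
  then obtain N where N: "\<And>n. n \<ge> N \<Longrightarrow> fn n x1 < fn n x2"
    by (auto simp: eventually_sequentially)
  have mono: "strict_mono_on ?I (fn n)" if "n \<ge> N" for n
  proof -
    have "\<not> strict_antimono_on ?I (fn n)"
      using N[OF that] x12 unfolding monotone_on_def by (meson less_asym)
    then show ?thesis using C1_homeomorphism_monotone[OF fn[of n]] by blast
  qed
  obtain r :: "nat \<Rightarrow> nat" where r: "strict_mono r"
    and aer: "AE x in lebesgue_on ?I. (\<lambda>n. deriv (fn (r n)) x) \<longlonglongrightarrow> F x"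
    using Lp_converges_AE_subseq[OF p Lp] by blast
  \<comment> \<open>A tail of the subsequence that consists of increasing maps only.\<close>
  define h where "h n = fn (r (n + N))" for n
  have hC: "C1_homeomorphism ?I (h n)" for n by (simp add: h_def fn)
  have hmono: "strict_mono_on ?I (h n)" for n
  proof -
    have "n + N \<le> r (n + N)" by (rule seq_suble[OF r])
    then show ?thesis unfolding h_def by (intro mono) auto
  qed
  have hlim: "(\<lambda>n. h n x) \<longlonglongrightarrow> f x" if "x \<in> ?I" for x
    using LIMSEQ_ignore_initial_segment[OF LIMSEQ_subseq_LIMSEQ[OF lim[OF that] r], of N]
    by (simp add: h_def o_def)
  have hder: "0 \<le> deriv (h n) x" if "x \<in> ?I" for n x
    by (rule strict_mono_on_deriv_nonneg[OF hmono C1_homeomorphism_has_derivative[OF hC that] that])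
  have fder: "0 \<le> deriv f x" if "x \<in> ?I" for x
    by (rule strict_mono_on_deriv_nonneg[OF f(2) C1_homeomorphism_has_derivative[OF f(1) that] that])
  have IL: "?I \<inter> space lebesgue \<in> sets lebesgue" by simp
  have aeh: "AE x in lebesgue. x \<in> ?I \<longrightarrow> (\<lambda>n. deriv (h n) x) \<longlonglongrightarrow> F x"
  proof -
    from aer have "AE x in lebesgue. x \<in> ?I \<longrightarrow> (\<lambda>n. deriv (fn (r n)) x) \<longlonglongrightarrow> F x"
      by (simp add: AE_restrict_space_iff)
    then show ?thesis
      by eventually_elim (auto simp: h_def intro: LIMSEQ_ignore_initial_segment)
  qed
  have Fpos: "AE x in lebesgue. x \<in> ?I \<longrightarrow> 0 \<le> F x"
    using aeh by eventually_elim (auto intro!: LIMSEQ_le_const hder)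
  define u where "u x = ennreal (F x) * indicator ?I x" for x
  define v where "v x = ennreal (deriv f x) * indicator ?I x" for x
  have meas: "(\<lambda>x. ennreal (w x) * indicator ?I x) \<in> borel_measurable lebesgue"
    if w: "w \<in> borel_measurable (lebesgue_on ?I)" for w :: "real \<Rightarrow> real"
    by (subst borel_measurable_restrict_space_iff_ennreal[OF IL, symmetric])
      (rule measurable_compose[OF w measurable_ennreal])
  have dmeas: "deriv w \<in> borel_measurable (lebesgue_on ?I)" if "C1_homeomorphism ?I w" for w
    by (rule continuous_imp_measurable_on_sets_lebesgue[OF C1_homeomorphism_continuous_deriv[OF that]]) simp
  have um: "u \<in> borel_measurable lebesgue" unfolding u_def
    using Lp by (intro meas) (auto simp: Lp_converges_def Lp_def)
  have vm: "v \<in> borel_measurable lebesgue" unfolding v_def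
    by (intro meas dmeas f(1))
  have le: "(\<integral>\<^sup>+x. u x * indicator {s..t} x \<partial>lebesgue) \<le> (\<integral>\<^sup>+x. v x * indicator {s..t} x \<partial>lebesgue)"
    if st: "a < s" "s \<le> t" "t < b" for s t
  proof -
    have sub: "w x * indicator ?I x * indicator {s..t} x = w x * indicator {s..t} x" for w :: "real \<Rightarrow> ennreal" and x
      using st by (auto split: split_indicator)
    define k where "k n x = ennreal (deriv (h n) x) * indicator {s..t} x" for n x
    have km: "k n \<in> borel_measurable lebesgue" for n
    proof -
      have [measurable]: "(\<lambda>x. ennreal (deriv (h n) x) * indicator ?I x) \<in> borel_measurable lebesgue"
        by (intro meas dmeas hC)
      have [measurable]: "{s..t} \<in> sets lebesgue" by simp
      have "(\<lambda>x. ennreal (deriv (h n) x) * indicator ?I x * indicator {s..t} x) \<in> borel_measurable lebesgue"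
        by measurable
      then show ?thesis
        by (simp only: sub[of "\<lambda>x. ennreal (deriv (h n) x)"] k_def[abs_def])
    qed
    have "(\<integral>\<^sup>+x. u x * indicator {s..t} x \<partial>lebesgue) \<le> (\<integral>\<^sup>+x. liminf (\<lambda>n. k n x) \<partial>lebesgue)"
    proof (rule nn_integral_mono_AE)
      show "AE x in lebesgue. u x * indicator {s..t} x \<le> liminf (\<lambda>n. k n x)"
        using aeh
      proof eventually_elim
        case (elim x)
        show ?case
        proof (cases "x \<in> {s..t}")
          case True
          then have "(\<lambda>n. k n x) \<longlonglongrightarrow> ennreal (F x)"
            using elim st by (auto simp: k_def)
          from lim_imp_Liminf[OF _ this] True st show ?thesis by (simp add: u_def)
        qed simp
      qed
    qed
    also have "\<dots> \<le> liminf (\<lambda>n. \<integral>\<^sup>+x. k n x \<partial>lebesgue)"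
      by (rule nn_integral_liminf) (rule km)
    also have "(\<lambda>n. \<integral>\<^sup>+x. k n x \<partial>lebesgue) = (\<lambda>n. ennreal (h n t - h n s))"
      unfolding k_def using nn_integral_deriv_strict_mono[OF hC hmono st] by simp
    also have "liminf \<dots> = ennreal (f t - f s)"
      using st by (intro lim_imp_Liminf tendsto_ennrealI tendsto_diff hlim) auto
    also have "\<dots> = (\<integral>\<^sup>+x. v x * indicator {s..t} x \<partial>lebesgue)"
      unfolding v_def sub[of "\<lambda>x. ennreal (deriv f x)"] by (rule nn_integral_deriv_strict_mono[OF f st, symmetric])
    finally show ?thesis .
  qed
  have "AE x in lebesgue. x \<in> {a + inverse (Suc n)..b - inverse (Suc n)} \<longrightarrow> u x \<le> v x" for n
  proof -
    let ?J = "{a + inverse (real (Suc n))..b - inverse (real (Suc n))}"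
    have pos: "inverse (real (Suc n)) > 0" by simp
    have JI: "?J \<subseteq> ?I"
    proof
      fix x assume "x \<in> ?J"
      with pos show "x \<in> ?I" unfolding atLeastAtMost_iff greaterThanLessThan_iff by linarith
    qed
    have "compact (deriv f ` ?J)"
      by (intro compact_continuous_image continuous_on_subset[OF C1_homeomorphism_continuous_deriv[OF f(1)] JI]) simp
    then obtain B where "\<forall>y\<in>deriv f ` ?J. norm y \<le> B"
      using compact_imp_bounded bounded_iff by blast
    then have "\<And>x. x \<in> ?J \<Longrightarrow> \<bar>deriv f x\<bar> \<le> B" by simp
    then have "v x \<le> ennreal B" if "x \<in> ?J" for x
      using that JI by (force simp: v_def intro!: ennreal_leI split: split_indicator)
    then show ?thesis
    proof (rule AE_le_of_interval_integrals_le[OF um vm])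
      fix s t :: real
      assume "a + inverse (real (Suc n)) \<le> s" "s \<le> t" "t \<le> b - inverse (real (Suc n))"
      with pos show "(\<integral>\<^sup>+x. u x * indicator {s..t} x \<partial>lebesgue) \<le> (\<integral>\<^sup>+x. v x * indicator {s..t} x \<partial>lebesgue)"
        by (intro le) linarith+
    qed
  qed
  then have "AE x in lebesgue. \<forall>n. x \<in> {a + inverse (Suc n)..b - inverse (Suc n)} \<longrightarrow> u x \<le> v x"
    by (simp only: AE_all_countable) blast
  with Fpos have "AE x in lebesgue. x \<in> ?I \<longrightarrow> 0 \<le> F x \<and> F x \<le> deriv f x"
  proof eventually_elim
    case (elim x)
    show ?case
    proof
      assume x: "x \<in> ?I"
      then obtain n where "inverse (real (Suc n)) < min (x - a) (b - x)"
        using reals_Archimedean[of "min (x - a) (b - x)"] by auto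
      then have "x \<in> {a + inverse (real (Suc n))..b - inverse (real (Suc n))}"
        unfolding min_less_iff_conj atLeastAtMost_iff by linarith
      then have "u x \<le> v x" using elim(2) by blast
      then show "0 \<le> F x \<and> F x \<le> deriv f x" using elim(1) x fder[OF x]
        by (simp add: u_def v_def ennreal_le_iff)
    qed
  qed
  then show ?thesis by (simp only: AE_restrict_space_iff[OF IL])
qed

section \<open>Smooth staircases\<close>

text \<open>The staircase below needs a step of class \<open>C\<^sup>1\<close> from \<open>0\<close> to \<open>1\<close>. Squares of positive parts are of
  class \<open>C\<^sup>1\<close>, so a step can be written as a second difference of them, with one closed formula on
  the whole line.\<close>

lemma has_derivative_max0_square:
  fixes x :: real
  shows "((\<lambda>x. (max 0 x)\<^sup>2) has_real_derivative 2 * max 0 x) (at x)"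
proof -
  consider "x < 0" | "x = 0" | "x > 0" by linarith
  then show ?thesis
  proof cases
    case 1
    have "((\<lambda>x. 0) has_real_derivative 2 * max 0 x) (at x)" using 1 by simp
    then show ?thesis
      by (rule has_field_derivative_transform_within_open[of _ _ _ "{..<0}"]) (use 1 in auto)
  next
    case 3
    have "((\<lambda>x. x\<^sup>2) has_real_derivative 2 * max 0 x) (at x)"
      using 3 by (auto intro!: derivative_eq_intros)
    then show ?thesis
      by (rule has_field_derivative_transform_within_open[of _ _ _ "{0<..}"]) (use 3 in auto)
  next
    case 2
    have "(\<lambda>h::real. (max 0 h)\<^sup>2 / h) \<midarrow>0\<rightarrow> 0"
    proof (rule Lim_null_comparison)
      show "\<forall>\<^sub>F h in at 0. norm ((max 0 h)\<^sup>2 / h) \<le> \<bar>h\<bar>"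
        by (intro always_eventually allI) (auto simp: max_def power2_eq_square)
      show "(\<lambda>h::real. \<bar>h\<bar>) \<midarrow>0\<rightarrow> 0" by (intro tendsto_rabs_zero tendsto_ident_at)
    qed
    then show ?thesis using 2 by (simp add: DERIV_def)
  qed
qed

text \<open>The piecewise linear bump of height \<open>2\<close> and integral \<open>1\<close> on the unit interval.\<close>

definition tent :: "real \<Rightarrow> real" where
  "tent t = 4 * max 0 t - 8 * max 0 (t - 1/2) + 4 * max 0 (t - 1)"

text \<open>The primitive of \<open>tent\<close> that vanishes on the left of \<open>0\<close>.\<close>

definition smooth_step :: "real \<Rightarrow> real" where
  "smooth_step t = 2 * (max 0 t)\<^sup>2 - 4 * (max 0 (t - 1/2))\<^sup>2 + 2 * (max 0 (t - 1))\<^sup>2"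

lemma smooth_step_has_derivative: "(smooth_step has_real_derivative tent t) (at t)"
proof -
  have shift: "((\<lambda>x. (max 0 (x - c))\<^sup>2) has_real_derivative 2 * max 0 (t - c)) (at t)" for c :: real
  proof -
    have "((\<lambda>x. x - c) has_real_derivative 1) (at t)" by (auto intro!: derivative_eq_intros)
    from DERIV_chain2[where f="\<lambda>x. (max 0 x)\<^sup>2" and g="\<lambda>x. x - c", OF has_derivative_max0_square this]
    show ?thesis by simp
  qed
  have "(smooth_step has_real_derivative
      2 * (2 * max 0 t) - 4 * (2 * max 0 (t - 1/2)) + 2 * (2 * max 0 (t - 1))) (at t)"
    unfolding smooth_step_def[abs_def]
    by (intro DERIV_add DERIV_diff DERIV_cmult has_derivative_max0_square shift)
  then show ?thesis by (simp add: tent_def)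
qed

lemma continuous_on_tent: "continuous_on S tent"
  unfolding tent_def[abs_def] by (intro continuous_intros)

lemma tent_nonneg: "0 \<le> tent t"
  by (auto simp: tent_def max_def)

lemma tent_eq_0: "t \<le> 0 \<or> 1 \<le> t \<Longrightarrow> tent t = 0"
  by (auto simp: tent_def max_def)

lemma smooth_step_eq_0: "t \<le> 0 \<Longrightarrow> smooth_step t = 0"
  by (auto simp: smooth_step_def max_def)

lemma smooth_step_eq_1: "1 \<le> t \<Longrightarrow> smooth_step t = 1"
  by (auto simp: smooth_step_def max_def power2_eq_square algebra_simps)

lemma smooth_step_mono: "s \<le> t \<Longrightarrow> smooth_step s \<le> smooth_step t"
  by (rule DERIV_nonneg_imp_nondecreasing) (use smooth_step_has_derivative tent_nonneg in blast)+

lemma smooth_step_bounds: "0 \<le> smooth_step t" "smooth_step t \<le> 1"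
proof -
  have "smooth_step (min t 0) \<le> smooth_step t" "smooth_step t \<le> smooth_step (max t 1)"
    by (auto intro: smooth_step_mono)
  then show "0 \<le> smooth_step t" "smooth_step t \<le> 1"
    by (simp_all add: smooth_step_eq_0 smooth_step_eq_1)
qed

lemma smooth_step_half: "smooth_step (1/2) = 1/2"
  by (simp add: smooth_step_def power2_eq_square)

lemma smooth_step_gt_half: "1/2 < t \<Longrightarrow> 1/2 < smooth_step t"
proof -
  assume t: "1/2 < t"
  have "smooth_step (min t 1) = 1 - 2 * (1 - min t 1)\<^sup>2"
    using t by (auto simp: smooth_step_def max_def min_def power2_eq_square algebra_simps)
  moreover have "(1 - min t 1)\<^sup>2 < (1/2)\<^sup>2"
    using t by (intro power_strict_mono) auto
  ultimately show ?thesis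
    using smooth_step_mono[of "min t 1" t] by (simp add: power2_eq_square)
qed

lemma smooth_step_lt_half: "t < 1/2 \<Longrightarrow> smooth_step t < 1/2"
proof -
  assume t: "t < 1/2"
  have "smooth_step (max t 0) = 2 * (max t 0)\<^sup>2"
    using t by (auto simp: smooth_step_def max_def)
  moreover have "(max t 0)\<^sup>2 < (1/2)\<^sup>2"
    using t by (intro power_strict_mono) auto
  ultimately show ?thesis
    using smooth_step_mono[of t "max t 0"] by (simp add: power2_eq_square)
qed

text \<open>A nondecreasing map of class \<open>C\<^sup>1\<close> that is uniformly close to the identity and yet flat off a
  set of small measure. It climbs by \<open>T = (b - a) / N\<close> within distance \<open>h/2\<close> of each grid point
  \<open>a + i T\<close>, and is flat in between. Steps are centred at the grid points, those at the endpoints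
  included, so that \<open>a\<close> and \<open>b\<close> lie halfway up a step: this fixes \<open>a\<close> and \<open>b\<close> and keeps interior points
  strictly inside, which matters later because the map is composed with a function that need not
  be differentiable at \<open>a\<close> and \<open>b\<close>.\<close>

lemma exists_staircase:
  fixes a b :: real
  assumes ab: "a < b" and \<delta>: "0 < \<delta>" and \<eta>: "0 < \<eta>"
  obtains w w' E where
    "\<And>x. (w has_real_derivative w' x) (at x)" "continuous_on UNIV w'" "\<And>x. 0 \<le> w' x"
    "w a = a" "w b = b"
    "\<And>x. x \<in> {a<..<b} \<Longrightarrow> w x \<in> {a<..<b}"
    "\<And>x. x \<in> {a<..<b} \<Longrightarrow> \<bar>w x - x\<bar> \<le> \<delta>"
    "E \<in> lmeasurable" "measure lebesgue E \<le> \<eta>" "\<And>x. x \<notin> E \<Longrightarrow> w' x = 0"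
proof -
  obtain N :: nat where N: "real N > (b - a) / \<delta>" using reals_Archimedean2 by blast
  have "(b - a) / \<delta> > 0" using ab \<delta> by simp
  then have N0: "real N > 0" using N by linarith
  define T where "T = (b - a) / real N"
  have T0: "T > 0" and T\<delta>: "T \<le> \<delta>" and NT: "real N * T = b - a"
    using N N0 ab \<delta> by (auto simp: T_def field_simps)
  define h where "h = min T (\<eta> / (real N + 1))"
  have h0: "h > 0" and hT: "h \<le> T" and hN: "(real N + 1) * h \<le> \<eta>"
  proof -
    show "h > 0" "h \<le> T" using T0 \<eta> by (auto simp: h_def)
    have "(real N + 1) * h \<le> (real N + 1) * (\<eta> / (real N + 1))"
      by (intro mult_left_mono) (auto simp: h_def)
    then show "(real N + 1) * h \<le> \<eta>" by simp
  qed
  define z where "z i x = (x - (a + real i * T)) / h + 1/2" for i :: nat and x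
  \<comment> \<open>The shift by \<open>T/2\<close> compensates the half step already climbed at \<open>a\<close>.\<close>
  define w where "w x = a - T/2 + T * (\<Sum>i\<le>N. smooth_step (z i x))" for x
  define w' where "w' x = T * (\<Sum>i\<le>N. tent (z i x) / h)" for x
  have z1: "1 \<le> z i x" if "x \<ge> a + (real i + 1/2) * T" for i x
  proof -
    have "h / 2 \<le> x - (a + real i * T)" using that hT by (auto simp: algebra_simps)
    then show ?thesis using h0 by (simp add: z_def field_simps)
  qed
  have z0: "z i x \<le> 0" if "x \<le> a + (real i - 1/2) * T" for i x
  proof -
    have "x - (a + real i * T) \<le> - h / 2" using that hT by (auto simp: algebra_simps)
    then show ?thesis using h0 by (simp add: z_def field_simps)
  qed
  have w_near: "\<bar>w x - x\<bar> \<le> T" if x: "a \<le> x" "x \<le> b" for x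
  proof -
    define t where "t = (x - a) / T"
    have t: "0 \<le> t" "t \<le> real N" and xt: "x = a + t * T"
      using x T0 NT by (auto simp: t_def field_simps)
    \<comment> \<open>The grid point closest to \<open>x\<close>: steps before it are complete, steps after it have not begun.\<close>
    define j where "j = nat \<lfloor>t + 1/2\<rfloor>"
    have j: "real j \<le> t + 1/2" "t + 1/2 < real j + 1" using t by (auto simp: j_def)
    then have jN: "j \<le> N" using t by linarith
    have "(\<Sum>i\<le>N. smooth_step (z i x)) = (\<Sum>i\<le>j. smooth_step (z i x))"
    proof (rule sum.mono_neutral_right)
      show "\<forall>i\<in>{..N} - {..j}. smooth_step (z i x) = 0"
      proof
        fix i assume "i \<in> {..N} - {..j}"
        then have "real j + 1 \<le> real i" by auto
        then have "t * T \<le> (real i - 1/2) * T" using j T0 by (intro mult_right_mono) auto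
        then show "smooth_step (z i x) = 0" by (intro smooth_step_eq_0 z0) (simp add: xt)
      qed
    qed (use jN in auto)
    also have "\<dots> = (\<Sum>i<j. smooth_step (z i x)) + smooth_step (z j x)"
      by (simp add: lessThan_Suc_atMost[symmetric])
    also have "(\<Sum>i<j. smooth_step (z i x)) = (\<Sum>i<j. 1)"
    proof (rule sum.cong[OF refl])
      fix i assume "i \<in> {..<j}"
      then have "real i + 1 \<le> real j" by auto
      then have "(real i + 1/2) * T \<le> t * T" using j T0 by (intro mult_right_mono) auto
      then show "smooth_step (z i x) = 1" by (intro smooth_step_eq_1 z1) (simp add: xt)
    qed
    finally have "w x - x = T * (real j + smooth_step (z j x) - 1/2 - t)"
      by (simp add: w_def xt algebra_simps)
    moreover have "\<bar>real j + smooth_step (z j x) - 1/2 - t\<bar> \<le> 1"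
      using j smooth_step_bounds[of "z j x"] by linarith
    ultimately show ?thesis using T0 by (simp add: abs_mult mult_left_le)
  qed
  have sum_a: "(\<Sum>i\<le>N. smooth_step (z i a)) = 1/2"
  proof -
    have "(\<Sum>i\<le>N. smooth_step (z i a)) = (\<Sum>i\<in>{0}. smooth_step (z i a))"
    proof (rule sum.mono_neutral_right)
      show "\<forall>i\<in>{..N} - {0}. smooth_step (z i a) = 0"
        using T0 by (auto intro!: smooth_step_eq_0 z0 mult_nonneg_nonneg)
    qed auto
    also have "\<dots> = 1/2" using smooth_step_half by (simp add: z_def)
    finally show ?thesis .
  qed
  have sumN: "(\<Sum>i\<le>N. g i) = (\<Sum>i<N. g i) + g N" for g :: "nat \<Rightarrow> real"
    by (simp add: lessThan_Suc_atMost[symmetric])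
  have sum_b: "(\<Sum>i\<le>N. smooth_step (z i b)) = real N + 1/2"
  proof -
    have "smooth_step (z i b) = 1" if "i < N" for i
    proof (intro smooth_step_eq_1 z1)
      have "real i + 1 \<le> real N" using that by auto
      then have "(real i + 1/2) * T \<le> real N * T" using T0 by (intro mult_right_mono) auto
      then show "a + (real i + 1/2) * T \<le> b" using NT by linarith
    qed
    moreover have "z N b = 1/2" using NT by (simp add: z_def)
    then have "smooth_step (z N b) = 1/2" by (simp only: smooth_step_half)
    ultimately show ?thesis by (simp add: sumN)
  qed
  have wa: "w a = a" and wb: "w b = b"
    using sum_a sum_b NT by (auto simp: w_def algebra_simps)
  have strict: "w x \<in> {a<..<b}" if x: "x \<in> {a<..<b}" for x
  proof -
    have "smooth_step (z 0 x) \<le> (\<Sum>i\<le>N. smooth_step (z i x))"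
      by (intro member_le_sum smooth_step_bounds) auto
    moreover have "1/2 < smooth_step (z 0 x)"
      using x h0 by (intro smooth_step_gt_half) (auto simp: z_def)
    ultimately have "T * (1/2) < T * (\<Sum>i\<le>N. smooth_step (z i x))"
      using T0 by (intro mult_strict_left_mono) auto
    then have "a < w x" by (simp add: w_def)
    have "smooth_step (z N x) < 1/2"
      using x h0 NT by (intro smooth_step_lt_half) (auto simp: z_def field_simps)
    moreover have "(\<Sum>i<N. smooth_step (z i x)) \<le> (\<Sum>i<N. 1)"
      by (intro sum_mono smooth_step_bounds)
    ultimately have "T * (\<Sum>i\<le>N. smooth_step (z i x)) < T * (real N + 1/2)"
      using T0 by (intro mult_strict_left_mono) (auto simp: sumN)
    then have "w x < b" using NT by (simp add: w_def algebra_simps)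
    with \<open>a < w x\<close> show ?thesis by simp
  qed
  define E where "E = (\<Union>i\<in>{..N}. {a + real i * T - h/2..a + real i * T + h/2})"
  have Em: "E \<in> lmeasurable" unfolding E_def
    by (intro fmeasurable.finite_UN) auto
  have "measure lebesgue E \<le> (\<Sum>i\<le>N. measure lebesgue {a + real i * T - h/2..a + real i * T + h/2})"
    unfolding E_def by (intro measure_UNION_le) auto
  also have "\<dots> \<le> \<eta>" using h0 hN by (simp add: algebra_simps)
  finally have E\<eta>: "measure lebesgue E \<le> \<eta>" .
  have E0: "w' x = 0" if "x \<notin> E" for x
  proof -
    have "tent (z i x) = 0" if "i \<le> N" for i
    proof -
      have "x \<notin> {a + real i * T - h/2..a + real i * T + h/2}"
        using \<open>x \<notin> E\<close> that by (auto simp: E_def)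
      then show ?thesis using h0 by (intro tent_eq_0) (auto simp: z_def field_simps)
    qed
    then show ?thesis by (simp add: w'_def)
  qed
  have der: "(w has_real_derivative w' x) (at x)" for x
  proof -
    have dz: "((\<lambda>x. smooth_step (z i x)) has_real_derivative tent (z i x) * (1 / h)) (at x)" for i
      by (rule DERIV_chain2[OF smooth_step_has_derivative])
        (use h0 in \<open>auto simp: z_def intro!: derivative_eq_intros\<close>)
    show ?thesis unfolding w_def[abs_def] w'_def
      using dz by (auto intro!: derivative_eq_intros simp: sum_distrib_left ac_simps)
  qed
  have "continuous_on UNIV w'"
  proof -
    have "continuous_on UNIV (\<lambda>x. tent (z i x))" for i
      using h0 unfolding z_def by (intro continuous_on_compose2[OF continuous_on_tent[of UNIV]] continuous_intros) auto
    then show ?thesis unfolding w'_def[abs_def] using h0 by (intro continuous_intros) auto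
  qed
  moreover have "0 \<le> w' x" for x
    unfolding w'_def using T0 h0 by (intro mult_nonneg_nonneg sum_nonneg divide_nonneg_pos tent_nonneg) auto
  moreover have "\<bar>w x - x\<bar> \<le> \<delta>" if "x \<in> {a<..<b}" for x
    using w_near[of x] T\<delta> that by auto
  ultimately show ?thesis using that[of w w' E] der wa wb strict Em E\<eta> E0 by blast
qed

section \<open>Concentrated mass is small in Lq for q < 1\<close>

lemma powr_le_add_one:
  fixes t :: real
  assumes "0 \<le> q" "q \<le> 1" "0 \<le> t"
  shows "t powr q \<le> 1 + t"
proof (cases "t \<le> 1")
  case True
  then have "t powr q \<le> 1 powr q" using assms by (intro powr_mono2) auto
  then show ?thesis using assms by simp
next
  case False
  then have "t powr q \<le> t powr 1" using assms by (intro powr_mono) auto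
  then show ?thesis using assms by simp
qed

lemma finite_measure_Ioo: "finite_measure (lebesgue_on {a<..<b :: real})"
  by (intro finite_measure_lebesgue_on) simp

lemma integrable_const_Ioo: "integrable (lebesgue_on {a<..<b :: real}) (\<lambda>x. c :: real)"
  by (rule finite_measure.integrable_const[OF finite_measure_Ioo])

lemma integrable_powr_of_integrable_bound:
  fixes u w :: "real \<Rightarrow> real"
  assumes q: "0 \<le> q" "q \<le> 1" and u: "u \<in> borel_measurable (lebesgue_on {a<..<b})"
    and w: "integrable (lebesgue_on {a<..<b}) w" and le: "AE x in lebesgue_on {a<..<b}. \<bar>u x\<bar> \<le> w x"
  shows "integrable (lebesgue_on {a<..<b}) (\<lambda>x. \<bar>u x\<bar> powr q)"
proof (rule Bochner_Integration.integrable_bound)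
  show "integrable (lebesgue_on {a<..<b}) (\<lambda>x. 1 + w x)"
    using w integrable_const_Ioo by (intro Bochner_Integration.integrable_add)
  show "(\<lambda>x. \<bar>u x\<bar> powr q) \<in> borel_measurable (lebesgue_on {a<..<b})"
    using u by measurable
  show "AE x in lebesgue_on {a<..<b}. norm (\<bar>u x\<bar> powr q) \<le> norm (1 + w x)"
    using le
  proof eventually_elim
    case (elim x)
    have "\<bar>u x\<bar> powr q \<le> 1 + \<bar>u x\<bar>" using q by (intro powr_le_add_one) auto
    with elim show ?case by simp
  qed
qed

text \<open>For \<open>t \<ge> 0\<close> and \<open>M > 0\<close> one has \<open>t\<^sup>q \<le> M\<^sup>q\<close> if \<open>t \<le> M\<close>, and \<open>t\<^sup>q = t\<^sup>q\<^sup>-\<^sup>1 t \<le> M\<^sup>q\<^sup>-\<^sup>1 t\<close> otherwise.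
  Since \<open>q < 1\<close>, the factor \<open>M\<^sup>q\<^sup>-\<^sup>1\<close> is small for large \<open>M\<close>; once \<open>M\<close> is chosen, the other term is small
  if \<open>u\<close> lives on a set \<open>E\<close> of small measure. So the integral of \<open>u\<close> need not be small at all.\<close>

lemma integral_powr_le_small_support:
  fixes u :: "real \<Rightarrow> real"
  assumes q: "0 < q" "q < 1" and M: "0 < M"
    and u: "integrable (lebesgue_on {a<..<b}) u" and nonneg: "\<And>x. x \<in> {a<..<b} \<Longrightarrow> 0 \<le> u x"
    and E: "E \<in> lmeasurable" and supp: "\<And>x. x \<notin> E \<Longrightarrow> u x = 0"
  shows "(\<integral>x. \<bar>u x\<bar> powr q \<partial>lebesgue_on {a<..<b})
    \<le> M powr (q - 1) * (\<integral>x. u x \<partial>lebesgue_on {a<..<b}) + M powr q * measure lebesgue E"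
proof -
  let ?L = "lebesgue_on {a<..<b}"
  have EI: "E \<inter> {a<..<b} \<in> sets ?L"
    using E by (auto simp: sets_restrict_space fmeasurable_def)
  have indint: "integrable ?L (indicat_real (E \<inter> {a<..<b}))"
    by (rule finite_measure.integrable_const_bound[OF finite_measure_Ioo, of _ 1])
      (use EI in \<open>auto split: split_indicator\<close>)
  have ind: "(\<integral>x. indicat_real (E \<inter> {a<..<b}) x \<partial>?L) \<le> measure lebesgue E"
  proof -
    have "(\<integral>x. indicat_real (E \<inter> {a<..<b}) x \<partial>?L) = measure ?L (E \<inter> {a<..<b})"
      by (subst Bochner_Integration.integral_indicator) (auto simp: Int_assoc)
    also have "\<dots> = measure lebesgue (E \<inter> {a<..<b})" by (intro measure_restrict_space) auto
    also have "\<dots> \<le> measure lebesgue E"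
      using E by (intro measure_mono_fmeasurable) (auto simp: fmeasurable_def)
    finally show ?thesis .
  qed
  have pt: "\<bar>u x\<bar> powr q \<le> M powr (q - 1) * u x + M powr q * indicat_real (E \<inter> {a<..<b}) x"
    if x: "x \<in> {a<..<b}" for x
  proof (cases "x \<in> E")
    case True
    show ?thesis
    proof (cases "u x \<le> M")
      case True
      then have "\<bar>u x\<bar> powr q \<le> M powr q" using nonneg[OF x] q by (intro powr_mono2) auto
      moreover have "0 \<le> M powr (q - 1) * u x" using nonneg[OF x] by simp
      ultimately show ?thesis using \<open>x \<in> E\<close> x by simp
    next
      case False
      then have pos: "0 < u x" using M by simp
      have "\<bar>u x\<bar> powr q = u x powr (q - 1) * u x"
        using pos by (simp add: powr_diff)
      also have "\<dots> \<le> M powr (q - 1) * u x"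
        using False pos q M by (intro mult_right_mono powr_mono2') auto
      finally show ?thesis using \<open>x \<in> E\<close> x by (simp add: add_increasing2)
    qed
  next
    case False
    then show ?thesis using supp[OF False] q by simp
  qed
  have "(\<integral>x. \<bar>u x\<bar> powr q \<partial>?L)
      \<le> (\<integral>x. M powr (q - 1) * u x + M powr q * indicat_real (E \<inter> {a<..<b}) x \<partial>?L)"
  proof (rule integral_mono_AE)
    show "integrable ?L (\<lambda>x. \<bar>u x\<bar> powr q)"
      using u q by (intro integrable_powr_of_integrable_bound[of q u a b "\<lambda>x. \<bar>u x\<bar>"]) auto
    show "integrable ?L (\<lambda>x. M powr (q - 1) * u x + M powr q * indicat_real (E \<inter> {a<..<b}) x)"
      using u indint by auto
  qed (use pt in \<open>auto intro!: AE_I2\<close>)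
  also have "\<dots> = M powr (q - 1) * (\<integral>x. u x \<partial>?L)
      + M powr q * (\<integral>x. indicat_real (E \<inter> {a<..<b}) x \<partial>?L)"
    using u indint by simp
  also have "\<dots> \<le> M powr (q - 1) * (\<integral>x. u x \<partial>?L) + M powr q * measure lebesgue E"
    using ind by (intro add_left_mono mult_left_mono) auto
  finally show ?thesis .
qed

section \<open>Sufficiency: concentrating the excess of the derivative\<close>

text \<open>A measurable \<open>F\<close> is an almost everywhere limit of continuous functions \<open>g n\<close>. Clipping them to the
  interval from \<open>d / (n + 2)\<close> to \<open>d\<close> keeps them continuous, makes them positive, and does not change the
  limit because \<open>0 \<le> F \<le> d\<close>; after clipping, dominated convergence applies.\<close>

lemma exists_continuous_density:
  fixes d F :: "real \<Rightarrow> real"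
  assumes q: "0 < q" "q < 1" and e: "0 < e"
    and d: "continuous_on {a<..<b} d" "\<And>x. x \<in> {a<..<b} \<Longrightarrow> 0 < d x"
    and dint: "integrable (lebesgue_on {a<..<b}) d"
    and F: "F \<in> borel_measurable (lebesgue_on {a<..<b})"
    and between: "AE x in lebesgue_on {a<..<b}. 0 \<le> F x \<and> F x \<le> d x"
  obtains \<phi> where "continuous_on {a<..<b} \<phi>" "\<And>x. x \<in> {a<..<b} \<Longrightarrow> 0 < \<phi> x \<and> \<phi> x \<le> d x"
    "(\<integral>x. \<bar>\<phi> x - F x\<bar> powr q \<partial>lebesgue_on {a<..<b}) < e"
proof -
  let ?I = "{a<..<b}" and ?L = "lebesgue_on {a<..<b}"
  have "F measurable_on ?I" using F by (simp add: measurable_on_iff_borel_measurable)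
  then obtain N g where N: "negligible N" and g: "\<And>n. continuous_on UNIV (g n)"
    and lim: "\<And>x. x \<notin> N \<Longrightarrow> (\<lambda>n. g n x) \<longlonglongrightarrow> (if x \<in> ?I then F x else 0)"
    unfolding measurable_on_def by blast
  define \<phi> where "\<phi> n x = max (d x / real (n + 2)) (min (g n x) (d x))" for n :: nat and x
  have cont: "continuous_on ?I (\<phi> n)" for n
    unfolding \<phi>_def[abs_def] using d(1) g[of n]
    by (intro continuous_intros) (auto intro: continuous_on_subset)
  have bounds: "0 < \<phi> n x \<and> \<phi> n x \<le> d x" if "x \<in> ?I" for n x
  proof -
    have "0 < d x / real (n + 2)" "d x / real (n + 2) \<le> d x"
      using d(2)[OF that] by (auto simp: field_simps)
    then show ?thesis by (auto simp: \<phi>_def)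
  qed
  have phim: "\<phi> n \<in> borel_measurable ?L" for n
    by (rule continuous_imp_measurable_on_sets_lebesgue[OF cont]) simp
  have "AE x in lebesgue. x \<notin> N" using N by (simp add: negligible_iff_null_sets AE_not_in)
  then have aeN: "AE x in ?L. x \<notin> N"
    by (simp add: AE_restrict_space_iff) (auto elim: eventually_mono)
  have aeI: "AE x in ?L. x \<in> ?I" by (rule AE_I2) simp
  have conv: "AE x in ?L. (\<lambda>n. \<phi> n x) \<longlonglongrightarrow> F x"
    using aeN aeI between
  proof eventually_elim
    case (elim x)
    have "(\<lambda>n. g n x) \<longlonglongrightarrow> F x" using lim[OF elim(1)] elim(2) by simp
    moreover have "(\<lambda>n. d x / real (n + 2)) \<longlonglongrightarrow> 0"
      by (rule LIMSEQ_ignore_initial_segment[OF lim_const_over_n])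
    ultimately have "(\<lambda>n. \<phi> n x) \<longlonglongrightarrow> max 0 (min (F x) (d x))"
      unfolding \<phi>_def by (intro tendsto_max tendsto_min tendsto_const)
    then show ?case using elim(3) by simp
  qed
  have "(\<lambda>n. \<integral>x. \<bar>\<phi> n x - F x\<bar> powr q \<partial>?L) \<longlonglongrightarrow> (\<integral>x. 0 \<partial>?L)"
  proof (rule integral_dominated_convergence[where w = "\<lambda>x. 1 + d x"])
    show "(\<lambda>x. \<bar>\<phi> n x - F x\<bar> powr q) \<in> borel_measurable ?L" for n
      using F phim by measurable
    show "integrable ?L (\<lambda>x. 1 + d x)"
      using dint integrable_const_Ioo by (intro Bochner_Integration.integrable_add)
    show "AE x in ?L. (\<lambda>n. \<bar>\<phi> n x - F x\<bar> powr q) \<longlonglongrightarrow> 0"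
      using conv
    proof eventually_elim
      case (elim x)
      then have "(\<lambda>n. \<bar>\<phi> n x - F x\<bar>) \<longlonglongrightarrow> 0"
        by (intro tendsto_rabs_zero) (simp add: LIM_zero)
      then show ?case using q by (intro tendsto_zero_powrI[OF _ tendsto_const]) auto
    qed
    show "AE x in ?L. norm (\<bar>\<phi> n x - F x\<bar> powr q) \<le> 1 + d x" for n
      using aeI between
    proof eventually_elim
      case (elim x)
      have "\<bar>\<phi> n x - F x\<bar> powr q \<le> 1 + \<bar>\<phi> n x - F x\<bar>" using q by (intro powr_le_add_one) auto
      moreover have "\<bar>\<phi> n x - F x\<bar> \<le> d x" using bounds[OF elim(1), of n] elim(2) by auto
      ultimately show ?case by simp
    qed
  qed auto
  then have "\<forall>\<^sub>F n in sequentially. (\<integral>x. \<bar>\<phi> n x - F x\<bar> powr q \<partial>?L) < e"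
    using e by (intro order_tendstoD) auto
  then obtain n where "(\<integral>x. \<bar>\<phi> n x - F x\<bar> powr q \<partial>?L) < e"
    by (auto simp: eventually_sequentially)
  then show ?thesis using that[of "\<phi> n"] cont bounds by blast
qed

lemma increasing_C1_homeomorphismI:
  fixes h D :: "real \<Rightarrow> real"
  assumes ab: "a < b" and cont: "continuous_on {a..b} h" and ends: "h a = a" "h b = b"
    and der: "\<And>x. x \<in> {a<..<b} \<Longrightarrow> (h has_real_derivative D x) (at x)"
    and D: "continuous_on {a<..<b} D" and pos: "\<And>x. x \<in> {a<..<b} \<Longrightarrow> 0 < D x"
  shows "C1_homeomorphism {a<..<b} h"
proof -
  have less: "h x < h y" if "a \<le> x" "x < y" "y \<le> b" for x y
  proof (rule DERIV_pos_imp_increasing_open[OF \<open>x < y\<close>])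
    show "\<exists>y. (h has_real_derivative y) (at t) \<and> 0 < y" if "x < t" "t < y" for t
      using der[of t] pos[of t] that \<open>a \<le> x\<close> \<open>y \<le> b\<close> by auto
    show "continuous_on {x..y} h"
      using cont by (rule continuous_on_subset) (use \<open>a \<le> x\<close> \<open>y \<le> b\<close> in auto)
  qed
  have "h ` {a<..<b} = {a<..<b}"
  proof
    show "h ` {a<..<b} \<subseteq> {a<..<b}"
      using less[of a] less[of _ b] ends by auto
    show "{a<..<b} \<subseteq> h ` {a<..<b}"
    proof
      fix y assume y: "y \<in> {a<..<b}"
      then obtain x where x: "a \<le> x" "x \<le> b" "h x = y"
        using IVT'[of h a y b] cont ends ab by auto
      then have "x \<noteq> a" "x \<noteq> b" using y ends by auto
      with x show "y \<in> h ` {a<..<b}" by auto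
    qed
  qed
  moreover have "inj_on h {a<..<b}"
  proof (rule linorder_inj_onI)
    show "h x \<noteq> h y" if "x < y" "x \<in> {a<..<b}" "y \<in> {a<..<b}" for x y
      using less[of x y] that by auto
  qed auto
  moreover have "continuous_on {a<..<b} h"
    using cont by (rule continuous_on_subset) auto
  moreover have "path_connected {a<..<b}" by (intro convex_imp_path_connected) auto
  ultimately have "\<exists>g. homeomorphism {a<..<b} {a<..<b} h g"
    by (intro homeomorphism_into_1d)
  moreover have "h C1_differentiable_on {a<..<b}"
    unfolding C1_differentiable_on_def using der D
    by (intro exI[of _ D]) (auto simp: has_real_derivative_iff_has_vector_derivative)
  ultimately show ?thesis by (simp add: C1_homeomorphism_def)
qed

text \<open>A monotone function with open range is continuous, and the extended function is onto. This yields
  continuity at \<open>a\<close> and \<open>b\<close> without computing one-sided limits.\<close>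

lemma continuous_extension_by_identity:
  fixes f :: "real \<Rightarrow> real"
  assumes mono: "strict_mono_on {a<..<b} f" and img: "f ` {a<..<b} = {a<..<b}"
  shows "continuous_on UNIV (\<lambda>x. if x \<in> {a<..<b} then f x else x)" (is "continuous_on _ ?g")
proof (rule continuous_onI_mono)
  have "y \<in> range ?g" for y
  proof (cases "y \<in> {a<..<b}")
    case True
    then obtain x where "x \<in> {a<..<b}" "y = f x" using img by (metis imageE)
    then have "y = ?g x" by simp
    then show ?thesis by blast
  next
    case False
    then have "y = ?g y" by (simp only: if_False)
    then show ?thesis by blast
  qed
  then have "range ?g = UNIV" by blast
  then show "open (range ?g)" by simp
next
  fix x y :: real
  assume "x \<le> y"
  have f: "a < f t \<and> f t < b" if "a < t" "t < b" for t
    using img that by (metis greaterThanLessThan_iff imageI)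
  have "f x \<le> f y" if "a < x" "y < b"
    using mono that \<open>x \<le> y\<close> by (cases "x = y") (auto simp: monotone_on_def less_imp_le)
  then show "?g x \<le> ?g y"
    using f[of x] f[of y] \<open>x \<le> y\<close> by auto
qed

lemma nonneg_has_integral_lebesgue_on:
  fixes u :: "real \<Rightarrow> real"
  assumes "(u has_integral v) S" "\<And>x. x \<in> S \<Longrightarrow> 0 \<le> u x" "S \<in> sets lebesgue"
  shows "integrable (lebesgue_on S) u" "(\<integral>x. u x \<partial>lebesgue_on S) = v"
proof -
  have "u absolutely_integrable_on S"
    using assms by (intro nonnegative_absolutely_integrable_1) auto
  then show i: "integrable (lebesgue_on S) u"
    by (rule absolutely_integrable_imp_integrable) fact
  show "(\<integral>x. u x \<partial>lebesgue_on S) = v"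
    using lebesgue_integral_eq_integral[OF i assms(3)] assms(1) by (simp add: integral_unique)
qed

text \<open>Split \<open>f = \<Phi> + R\<close>, where \<open>\<Phi>\<close> is the primitive of \<open>\<phi>\<close> and \<open>R' = f' - \<phi> \<ge> 0\<close>, and replace \<open>R\<close> by \<open>R \<circ> w\<close>
  for a staircase \<open>w\<close>. As \<open>R\<close> is uniformly continuous on \<open>{a..b}\<close> and \<open>w\<close> is close to the identity, the
  sum stays uniformly close to \<open>f\<close>. Its derivative differs from \<open>\<phi>\<close> by \<open>(R \<circ> w)'\<close>, which has total
  mass at most \<open>b - a\<close> and lives where \<open>w' \<noteq> 0\<close>, a set of small measure.\<close>

lemma exists_C1_homeomorphism_derivative_near:
  fixes f \<phi> :: "real \<Rightarrow> real"
  assumes q: "0 < q" "q < 1" and e: "0 < e" and ab: "a < b"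
    and f: "C1_homeomorphism {a<..<b} f" "strict_mono_on {a<..<b} f"
    and dint: "integrable (lebesgue_on {a<..<b}) (deriv f)"
    and \<phi>: "continuous_on {a<..<b} \<phi>" "\<And>x. x \<in> {a<..<b} \<Longrightarrow> 0 < \<phi> x \<and> \<phi> x \<le> deriv f x"
  obtains h where "C1_homeomorphism {a<..<b} h" "\<And>x. x \<in> {a<..<b} \<Longrightarrow> \<bar>h x - f x\<bar> \<le> e"
    "integrable (lebesgue_on {a<..<b}) (deriv h)"
    "(\<integral>x. \<bar>deriv h x - \<phi> x\<bar> powr q \<partial>lebesgue_on {a<..<b}) \<le> e"
proof -
  let ?I = "{a<..<b}" and ?L = "lebesgue_on {a<..<b}"
  have phim: "\<phi> \<in> borel_measurable ?L"
    by (rule continuous_imp_measurable_on_sets_lebesgue[OF \<phi>(1)]) simp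
  have phiint: "integrable ?L \<phi>"
  proof (rule Bochner_Integration.integrable_bound[OF dint phim])
    show "AE x in ?L. norm (\<phi> x) \<le> norm (deriv f x)"
    proof (rule AE_I2)
      fix x assume "x \<in> space ?L"
      then show "norm (\<phi> x) \<le> norm (deriv f x)" using \<phi>(2)[of x] by simp
    qed
  qed
  then have phiI: "\<phi> integrable_on {a..b}"
    by (simp add: integrable_on_lebesgue_on integrable_on_Icc_iff_Ioo)
  define \<Phi> where "\<Phi> x = integral {a..x} \<phi>" for x
  have \<Phi>cont: "continuous_on {a..b} \<Phi>"
    unfolding \<Phi>_def[abs_def] by (rule indefinite_integral_continuous_1[OF phiI])
  have \<Phi>der: "(\<Phi> has_real_derivative \<phi> x) (at x)" if x: "x \<in> ?I" for x
  proof -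
    have "continuous (at x) \<phi>"
      using \<phi>(1) x by (simp add: continuous_on_eq_continuous_at)
    then have "(\<Phi> has_vector_derivative \<phi> x) (at x within {a..b})"
      using integral_has_vector_derivative_continuous_at[OF phiI, of x "{}"] x
      by (auto simp: \<Phi>_def[abs_def] continuous_at_imp_continuous_at_within)
    then show ?thesis
      using x by (simp add: has_real_derivative_iff_has_vector_derivative at_within_Icc_at)
  qed
  have \<Phi>a: "\<Phi> a = 0" by (simp add: \<Phi>_def)
  have \<Phi>b: "0 \<le> \<Phi> b"
  proof -
    have "\<Phi> b = integral ?I \<phi>" by (simp add: \<Phi>_def integral_open_interval_real)
    also have "\<dots> \<ge> 0"
      using phiI \<phi>(2) by (intro integral_nonneg) (auto simp: integrable_on_Icc_iff_Ioo less_imp_le)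
    finally show ?thesis .
  qed
  define fb where "fb x = (if x \<in> ?I then f x else x)" for x
  have fbcont: "continuous_on UNIV fb"
    unfolding fb_def[abs_def]
    by (rule continuous_extension_by_identity[OF f(2) C1_homeomorphism_image[OF f(1)]])
  have fbder: "(fb has_real_derivative deriv f x) (at x)" if "x \<in> ?I" for x
    by (rule has_field_derivative_transform_within_open[OF C1_homeomorphism_has_derivative[OF f(1) that], of ?I])
      (use that in \<open>auto simp: fb_def\<close>)
  define R where "R x = fb x - \<Phi> x" for x
  define \<rho> where "\<rho> x = deriv f x - \<phi> x" for x
  have Rcont: "continuous_on {a..b} R"
    unfolding R_def[abs_def] using fbcont \<Phi>cont
    by (intro continuous_on_diff) (auto intro: continuous_on_subset)
  have Rder: "(R has_real_derivative \<rho> x) (at x)" if "x \<in> ?I" for x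
    unfolding R_def[abs_def] \<rho>_def by (intro DERIV_diff fbder \<Phi>der that)
  have rho_cont: "continuous_on ?I \<rho>"
    unfolding \<rho>_def[abs_def]
    by (intro continuous_on_diff C1_homeomorphism_continuous_deriv[OF f(1)] \<phi>(1))
  have rho_nonneg: "0 \<le> \<rho> x" if "x \<in> ?I" for x using \<phi>(2)[OF that] by (simp add: \<rho>_def)
  have "uniformly_continuous_on {a..b} R"
    by (rule compact_uniformly_continuous[OF Rcont]) simp
  then obtain \<delta> where \<delta>: "\<delta> > 0"
    "\<And>x x'. x \<in> {a..b} \<Longrightarrow> x' \<in> {a..b} \<Longrightarrow> dist x' x < \<delta> \<Longrightarrow> dist (R x') (R x) < e"
    by (rule uniformly_continuous_onE[OF _ e]) blast
  \<comment> \<open>The constants balance the two terms of the estimate for concentrated mass: the first is \<open>e / 2\<close>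
    for mass \<open>b - a\<close>, and then \<open>\<eta>\<close> makes the second \<open>e / 2\<close>.\<close>
  define M where "M = (2 * (b - a) / e) powr (1 / (1 - q))"
  have M: "0 < M" and Mq: "M powr (q - 1) * (b - a) \<le> e / 2"
  proof -
    show "0 < M" using ab e by (simp add: M_def)
    have "1 / (1 - q) * (q - 1) = - 1" using q by (simp add: field_simps)
    then have "M powr (q - 1) = (2 * (b - a) / e) powr (- 1)"
      unfolding M_def by (simp only: powr_powr)
    also have "\<dots> = e / (2 * (b - a))" using ab e by (simp add: powr_minus)
    finally have "M powr (q - 1) * (b - a) = e / (2 * (b - a)) * (b - a)" by (rule arg_cong)
    also have "\<dots> = e / 2" using nonzero_mult_divide_mult_cancel_right[of "b - a" e 2] ab by simp
    finally show "M powr (q - 1) * (b - a) \<le> e / 2" by (rule eq_refl)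
  qed
  define \<eta> where "\<eta> = e / (2 * M powr q)"
  have \<eta>: "0 < \<eta>" and Meta: "M powr q * \<eta> = e / 2" using M e by (auto simp: \<eta>_def)
  obtain w w' E where w: "\<And>x. (w has_real_derivative w' x) (at x)" "continuous_on UNIV w'" "\<And>x. 0 \<le> w' x"
    and wends: "w a = a" "w b = b" and wI: "\<And>x. x \<in> ?I \<Longrightarrow> w x \<in> ?I"
    and wnear: "\<And>x. x \<in> ?I \<Longrightarrow> \<bar>w x - x\<bar> \<le> \<delta> / 2"
    and E: "E \<in> lmeasurable" "measure lebesgue E \<le> \<eta>" "\<And>x. x \<notin> E \<Longrightarrow> w' x = 0"
    using exists_staircase[OF ab, of "\<delta> / 2" \<eta>] \<delta>(1) \<eta> by (metis half_gt_zero)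
  have wcont: "continuous_on S w" for S
    using w(1) DERIV_continuous_on has_field_derivative_at_within by metis
  have wIcc: "w x \<in> {a..b}" if "x \<in> {a..b}" for x
    using that wends wI[of x] by (cases "x = a"; cases "x = b") auto
  have Rwcont: "continuous_on {a..b} (\<lambda>x. R (w x))"
    by (rule continuous_on_compose2[OF Rcont wcont]) (use wIcc in auto)
  define u where "u x = \<rho> (w x) * w' x" for x
  have Rwder: "((\<lambda>x. R (w x)) has_real_derivative u x) (at x)" if "x \<in> ?I" for x
    unfolding u_def by (rule DERIV_chain2[OF Rder[OF wI[OF that]] w(1)])
  have ucont: "continuous_on ?I u"
    unfolding u_def[abs_def] using w(2) wI
    by (intro continuous_on_mult continuous_on_compose2[OF rho_cont wcont]) (auto intro: continuous_on_subset)
  have u_nonneg: "0 \<le> u x" if "x \<in> ?I" for x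
    unfolding u_def using rho_nonneg[OF wI[OF that]] w(3) by simp
  have "(u has_integral (R (w b) - R (w a))) {a..b}"
    using ab Rwcont Rwder by (intro fundamental_theorem_of_calculus_interior)
      (auto simp: has_real_derivative_iff_has_vector_derivative)
  then have "(u has_integral (b - a - \<Phi> b)) ?I"
    by (simp add: has_integral_Icc_iff_Ioo wends R_def fb_def \<Phi>a algebra_simps)
  from nonneg_has_integral_lebesgue_on[OF this u_nonneg]
  have uint: "integrable ?L u" and uval: "(\<integral>x. u x \<partial>?L) \<le> b - a" using \<Phi>b by auto
  define h where "h x = \<Phi> x + R (w x)" for x
  have hder: "(h has_real_derivative \<phi> x + u x) (at x)" if "x \<in> ?I" for x
    unfolding h_def[abs_def] by (intro DERIV_add \<Phi>der Rwder that)
  have hC: "C1_homeomorphism ?I h"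
  proof (rule increasing_C1_homeomorphismI[OF ab _ _ _ hder])
    show "continuous_on {a..b} h"
      unfolding h_def[abs_def] by (intro continuous_on_add \<Phi>cont Rwcont)
    show "h a = a" "h b = b" by (simp_all add: h_def wends R_def fb_def \<Phi>a)
    show "continuous_on ?I (\<lambda>x. \<phi> x + u x)" by (intro continuous_on_add \<phi>(1) ucont)
    show "0 < \<phi> x + u x" if "x \<in> ?I" for x
      using \<phi>(2)[OF that] u_nonneg[OF that] by simp
  qed
  have hderiv: "deriv h x = \<phi> x + u x" if "x \<in> ?I" for x
    by (rule DERIV_imp_deriv[OF hder[OF that]])
  have "\<bar>h x - f x\<bar> \<le> e" if x: "x \<in> ?I" for x
  proof -
    have "dist (R (w x)) (R x) < e"
      using wnear[OF x] wI[OF x] x \<delta>(1) by (intro \<delta>(2)) (auto simp: dist_real_def)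
    then show ?thesis using x by (simp add: h_def R_def fb_def dist_real_def)
  qed
  moreover have "integrable ?L (deriv h)"
  proof -
    have "integrable ?L (\<lambda>x. \<phi> x + u x)" using phiint uint by simp
    then show ?thesis
      by (subst Bochner_Integration.integrable_cong[OF refl, of _ _ "\<lambda>x. \<phi> x + u x"]) (auto simp: hderiv)
  qed
  moreover have "(\<integral>x. \<bar>deriv h x - \<phi> x\<bar> powr q \<partial>?L) \<le> e"
  proof -
    have "(\<integral>x. \<bar>deriv h x - \<phi> x\<bar> powr q \<partial>?L) = (\<integral>x. \<bar>u x\<bar> powr q \<partial>?L)"
      by (intro Bochner_Integration.integral_cong) (auto simp: hderiv)
    also have "\<dots> \<le> M powr (q - 1) * (\<integral>x. u x \<partial>?L) + M powr q * measure lebesgue E"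
      by (rule integral_powr_le_small_support[OF q M uint u_nonneg E(1)]) (simp_all add: u_def E(3))
    also have "\<dots> \<le> M powr (q - 1) * (b - a) + M powr q * \<eta>"
      using uval E(2) by (intro add_mono mult_left_mono) auto
    also have "\<dots> \<le> e" using Mq Meta by simp
    finally show ?thesis .
  qed
  ultimately show ?thesis using that[of h] hC by blast
qed

lemma C1_homeomorphism_mem_Lp:
  assumes f: "C1_homeomorphism {a<..<b} f" and p: "0 \<le> p"
  shows "f \<in> Lp p {a<..<b}"
proof -
  have [measurable]: "f \<in> borel_measurable (lebesgue_on {a<..<b})"
    by (rule continuous_imp_measurable_on_sets_lebesgue[OF C1_homeomorphism_continuous_on[OF f]]) simp
  have "integrable (lebesgue_on {a<..<b}) (\<lambda>x. \<bar>f x\<bar> powr p)"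
  proof (rule finite_measure.integrable_const_bound[OF finite_measure_Ioo, of _ "(\<bar>a\<bar> + \<bar>b\<bar>) powr p"])
    show "AE x in lebesgue_on {a<..<b}. norm (\<bar>f x\<bar> powr p) \<le> (\<bar>a\<bar> + \<bar>b\<bar>) powr p"
    proof (rule AE_I2)
      fix x assume "x \<in> space (lebesgue_on {a<..<b})"
      then have "f x \<in> {a<..<b}" using C1_homeomorphism_image[OF f] by auto
      then have "\<bar>f x\<bar> \<le> \<bar>a\<bar> + \<bar>b\<bar>" by auto
      then show "norm (\<bar>f x\<bar> powr p) \<le> (\<bar>a\<bar> + \<bar>b\<bar>) powr p" using p by (simp add: powr_mono2)
    qed
  qed measurable
  then show ?thesis by (simp add: Lp_def)
qed

text \<open>Two approximations are chained: \<open>F\<close> by a continuous density \<open>\<phi>\<close>, and \<open>\<phi>\<close> by the derivative of a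
  homeomorphism that is uniformly close to \<open>f\<close>.\<close>

lemma AE_between_imp_M1p:
  fixes f F :: "real \<Rightarrow> real"
  assumes q: "0 < q" "q < 1" and ab: "a < b"
    and f: "C1_homeomorphism {a<..<b} f" "strict_mono_on {a<..<b} f"
    and pos: "\<And>x. x \<in> {a<..<b} \<Longrightarrow> 0 < deriv f x"
    and dint: "integrable (lebesgue_on {a<..<b}) (deriv f)"
    and F: "F \<in> borel_measurable (lebesgue_on {a<..<b})"
    and between: "AE x in lebesgue_on {a<..<b}. 0 \<le> F x \<and> F x \<le> deriv f x"
  shows "(f, F) \<in> M1p q {a<..<b}"
proof -
  let ?I = "{a<..<b}" and ?L = "lebesgue_on {a<..<b}"
  have dmeas: "deriv w \<in> borel_measurable ?L" if "C1_homeomorphism ?I w" for w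
    by (rule continuous_imp_measurable_on_sets_lebesgue[OF C1_homeomorphism_continuous_deriv[OF that]]) simp
  have FLp: "F \<in> Lp q ?I"
  proof -
    have "AE x in ?L. \<bar>F x\<bar> \<le> deriv f x" using between by eventually_elim simp
    then show ?thesis
      using integrable_powr_of_integrable_bound[of q F a b "deriv f"] q F dint by (simp add: Lp_def)
  qed
  have approx: "\<exists>h. C1_homeomorphism ?I h \<and> (\<forall>x\<in>?I. \<bar>h x - f x\<bar> \<le> e) \<and> deriv h \<in> Lp q ?I
      \<and> (\<integral>x. \<bar>deriv h x - F x\<bar> powr q \<partial>?L) \<le> 2 powr q * (2 * e)" if e: "e > 0" for e
  proof -
    obtain \<phi> where \<phi>: "continuous_on ?I \<phi>" "\<And>x. x \<in> ?I \<Longrightarrow> 0 < \<phi> x \<and> \<phi> x \<le> deriv f x"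
      and \<phi>F: "(\<integral>x. \<bar>\<phi> x - F x\<bar> powr q \<partial>?L) < e"
      by (rule exists_continuous_density[OF q e C1_homeomorphism_continuous_deriv[OF f(1)] pos dint F between]) (assumption | rule that)+
    obtain h where h: "C1_homeomorphism ?I h" "\<And>x. x \<in> ?I \<Longrightarrow> \<bar>h x - f x\<bar> \<le> e"
      and hint: "integrable ?L (deriv h)"
      and h\<phi>: "(\<integral>x. \<bar>deriv h x - \<phi> x\<bar> powr q \<partial>?L) \<le> e"
      using exists_C1_homeomorphism_derivative_near[OF q e ab f dint \<phi>] by blast
    have phim: "\<phi> \<in> borel_measurable ?L"
      by (rule continuous_imp_measurable_on_sets_lebesgue[OF \<phi>(1)]) simp
    have hLp: "deriv h \<in> Lp q ?I"
      using integrable_powr_of_integrable_bound[of q "deriv h" a b "\<lambda>x. \<bar>deriv h x\<bar>"] q dmeas[OF h(1)] hint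
      by (auto simp: Lp_def)
    have \<phi>Lp: "\<phi> \<in> Lp q ?I"
      using integrable_powr_of_integrable_bound[of q \<phi> a b "deriv f"] q phim dint \<phi>(2)
      by (fastforce simp: Lp_def intro: AE_I2)
    have int: "integrable ?L (\<lambda>x. \<bar>s x - t x\<bar> powr q)" if "s \<in> Lp q ?I" "t \<in> Lp q ?I" for s t
      using Lp_diff[OF q(1) that] by (simp add: Lp_def)
    have "(\<integral>x. \<bar>deriv h x - F x\<bar> powr q \<partial>?L)
        \<le> (\<integral>x. 2 powr q * (\<bar>deriv h x - \<phi> x\<bar> powr q + \<bar>\<phi> x - F x\<bar> powr q) \<partial>?L)"
    proof (rule integral_mono)
      show "\<bar>deriv h x - F x\<bar> powr q \<le> 2 powr q * (\<bar>deriv h x - \<phi> x\<bar> powr q + \<bar>\<phi> x - F x\<bar> powr q)" for x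
        using abs_diff_powr_le[OF q(1), of "deriv h x - \<phi> x" "F x - \<phi> x"]
        by (simp add: abs_minus_commute)
    qed (use int hLp \<phi>Lp FLp in auto)
    also have "\<dots> = 2 powr q * ((\<integral>x. \<bar>deriv h x - \<phi> x\<bar> powr q \<partial>?L) + (\<integral>x. \<bar>\<phi> x - F x\<bar> powr q \<partial>?L))"
      using int hLp \<phi>Lp FLp by simp
    also have "\<dots> \<le> 2 powr q * (2 * e)"
      using h\<phi> \<phi>F by (intro mult_left_mono) auto
    finally show ?thesis using h hLp by blast
  qed
  have "\<forall>n. \<exists>h. C1_homeomorphism ?I h \<and> (\<forall>x\<in>?I. \<bar>h x - f x\<bar> \<le> inverse (real (Suc n))) \<and> deriv h \<in> Lp q ?I
      \<and> (\<integral>x. \<bar>deriv h x - F x\<bar> powr q \<partial>?L) \<le> 2 powr q * (2 * inverse (real (Suc n)))"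
  proof
    fix n
    show "\<exists>h. C1_homeomorphism ?I h \<and> (\<forall>x\<in>?I. \<bar>h x - f x\<bar> \<le> inverse (real (Suc n))) \<and> deriv h \<in> Lp q ?I
      \<and> (\<integral>x. \<bar>deriv h x - F x\<bar> powr q \<partial>?L) \<le> 2 powr q * (2 * inverse (real (Suc n)))"
      by (rule approx) simp
  qed
  from choice[OF this] obtain h where h: "\<And>n. C1_homeomorphism ?I (h n)"
    and hf: "\<And>n x. x \<in> ?I \<Longrightarrow> \<bar>h n x - f x\<bar> \<le> inverse (real (Suc n))"
    and hLp: "\<And>n. deriv (h n) \<in> Lp q ?I"
    and hF: "\<And>n. (\<integral>x. \<bar>deriv (h n) x - F x\<bar> powr q \<partial>?L) \<le> 2 powr q * (2 * inverse (real (Suc n)))"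
    by blast
  have "uniform_limit ?I h f sequentially"
    unfolding uniform_limit_iff
  proof (intro allI impI)
    fix e :: real assume "e > 0"
    then have "\<forall>\<^sub>F n in sequentially. inverse (real (Suc n)) < e"
      by (intro order_tendstoD[OF LIMSEQ_inverse_real_of_nat])
    then show "\<forall>\<^sub>F n in sequentially. \<forall>x\<in>?I. dist (h n x) (f x) < e"
    proof eventually_elim
      case (elim n)
      show ?case
      proof
        fix x assume "x \<in> ?I"
        from hf[OF this, of n] elim show "dist (h n x) (f x) < e"
          unfolding dist_real_def by (rule le_less_trans)
      qed
    qed
  qed
  moreover have "Lp_converges q ?I (\<lambda>n. deriv (h n)) F"
  proof -
    have "(\<lambda>n. \<integral>x. \<bar>deriv (h n) x - F x\<bar> powr q \<partial>?L) \<longlonglongrightarrow> 0"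
    proof (rule tendsto_sandwich[OF _ _ tendsto_const])
      show "\<forall>\<^sub>F n in sequentially. 0 \<le> (\<integral>x. \<bar>deriv (h n) x - F x\<bar> powr q \<partial>?L)" by simp
      show "\<forall>\<^sub>F n in sequentially. (\<integral>x. \<bar>deriv (h n) x - F x\<bar> powr q \<partial>?L)
          \<le> 2 powr q * (2 * inverse (real (Suc n)))"
        using hF by (intro always_eventually allI)
      show "(\<lambda>n. 2 powr q * (2 * inverse (real (Suc n)))) \<longlonglongrightarrow> 0"
        by (intro tendsto_mult_right_zero LIMSEQ_inverse_real_of_nat)
    qed
    then have "(\<lambda>n. Lp_norm q ?I (\<lambda>x. deriv (h n) x - F x)) \<longlonglongrightarrow> 0"
      unfolding Lp_norm_def using q by (intro tendsto_zero_powrI[OF _ tendsto_const]) auto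
    then show ?thesis using hLp FLp by (simp add: Lp_converges_def)
  qed
  moreover have "f \<in> Lp q ?I" using q by (intro C1_homeomorphism_mem_Lp f) auto
  ultimately show ?thesis using h FLp by (auto simp: M1p_def intro!: exI[of _ h] exI[of _ f])
qed

section \<open>Reflection and the characterization\<close>

lemma Lp_cong:
  assumes "\<And>x. x \<in> S \<Longrightarrow> u x = v x"
  shows "u \<in> Lp p S \<longleftrightarrow> v \<in> Lp p S"
proof -
  have "u \<in> borel_measurable (lebesgue_on S) \<longleftrightarrow> v \<in> borel_measurable (lebesgue_on S)"
    using assms by (intro measurable_cong) auto
  moreover have "integrable (lebesgue_on S) (\<lambda>x. \<bar>u x\<bar> powr p) \<longleftrightarrow> integrable (lebesgue_on S) (\<lambda>x. \<bar>v x\<bar> powr p)"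
    using assms by (intro Bochner_Integration.integrable_cong) auto
  ultimately show ?thesis by (simp add: Lp_def)
qed

lemma Lp_uminus_iff: "(\<lambda>x. - u x) \<in> Lp p S \<longleftrightarrow> u \<in> Lp p S"
  using borel_measurable_uminus_eq[of u "lebesgue_on S"] by (simp add: Lp_def)

lemma
  assumes h: "C1_homeomorphism {a<..<b} h"
  shows C1_homeomorphism_reflect: "C1_homeomorphism {a<..<b} (\<lambda>x. a + b - h x)"
    and deriv_reflect: "\<And>x. x \<in> {a<..<b} \<Longrightarrow> deriv (\<lambda>x. a + b - h x) x = - deriv h x"
proof -
  let ?I = "{a<..<b}" and ?k = "\<lambda>x. a + b - h x"
  have der: "(?k has_real_derivative - deriv h x) (at x)" if "x \<in> ?I" for x
    using C1_homeomorphism_has_derivative[OF h that] by (auto intro!: derivative_eq_intros)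
  then show "\<And>x. x \<in> ?I \<Longrightarrow> deriv ?k x = - deriv h x" by (rule DERIV_imp_deriv)
  have "?k ` ?I = (\<lambda>y. a + b - y) ` (h ` ?I)" by (simp add: image_image)
  also have "\<dots> = ?I"
    unfolding C1_homeomorphism_image[OF h]
  proof
    show "?I \<subseteq> (\<lambda>y. a + b - y) ` ?I"
    proof
      fix y assume "y \<in> ?I"
      then show "y \<in> (\<lambda>y. a + b - y) ` ?I" by (intro image_eqI[of _ _ "a + b - y"]) auto
    qed
  qed auto
  finally have "?k ` ?I = ?I" .
  moreover have "inj_on ?k ?I"
    using C1_homeomorphism_inj_on[OF h] by (auto simp: inj_on_def)
  moreover have "continuous_on ?I ?k"
    by (intro continuous_intros C1_homeomorphism_continuous_on[OF h])
  moreover have "path_connected ?I" by (intro convex_imp_path_connected) auto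
  ultimately have "\<exists>g. homeomorphism ?I ?I ?k g" by (intro homeomorphism_into_1d)
  moreover have "?k C1_differentiable_on ?I"
    unfolding C1_differentiable_on_def has_real_derivative_iff_has_vector_derivative[symmetric]
    using der C1_homeomorphism_continuous_deriv[OF h]
    by (intro exI[of _ "\<lambda>x. - deriv h x"]) (auto intro: continuous_on_minus)
  ultimately show "C1_homeomorphism ?I ?k" by (simp add: C1_homeomorphism_def)
qed

text \<open>This reduces decreasing homeomorphisms to increasing ones; the values are reflected rather than
  the variable, so that all measure-theoretic conditions stay at the same point.\<close>

lemma M1p_reflect:
  assumes p: "0 < p" and f: "C1_homeomorphism {a<..<b} f" and M: "(f, F) \<in> M1p p {a<..<b}"
  shows "(\<lambda>x. a + b - f x, \<lambda>x. - F x) \<in> M1p p {a<..<b}"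
proof -
  let ?I = "{a<..<b}"
  obtain fn g where fn: "\<And>n. C1_homeomorphism ?I (fn n)"
    and ae: "AE x in lebesgue_on ?I. g x = f x"
    and unif: "uniform_limit ?I fn g sequentially"
    and Lp: "Lp_converges p ?I (\<lambda>n. deriv (fn n)) F"
    using M by (auto simp: M1p_def)
  define k where "k n x = a + b - fn n x" for n x
  have k: "C1_homeomorphism ?I (k n)" and dk: "x \<in> ?I \<Longrightarrow> deriv (k n) x = - deriv (fn n) x" for n x
    unfolding k_def[abs_def] by (rule C1_homeomorphism_reflect[OF fn], rule deriv_reflect[OF fn])
  have "AE x in lebesgue_on ?I. a + b - g x = a + b - f x" using ae by eventually_elim simp
  moreover have "uniform_limit ?I k (\<lambda>x. a + b - g x) sequentially"
    using unif by (simp add: uniform_limit_iff k_def dist_real_def abs_minus_commute)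
  moreover have "Lp_converges p ?I (\<lambda>n. deriv (k n)) (\<lambda>x. - F x)"
  proof -
    have "deriv (k n) \<in> Lp p ?I" for n
      using Lp Lp_cong[of ?I "deriv (k n)" "\<lambda>x. - deriv (fn n) x" p, OF dk] by (simp add: Lp_converges_def Lp_uminus_iff)
    moreover have "Lp_norm p ?I (\<lambda>x. deriv (k n) x - - F x) = Lp_norm p ?I (\<lambda>x. deriv (fn n) x - F x)" for n
    proof -
      have "(\<integral>x. \<bar>deriv (k n) x - - F x\<bar> powr p \<partial>lebesgue_on ?I)
          = (\<integral>x. \<bar>deriv (fn n) x - F x\<bar> powr p \<partial>lebesgue_on ?I)"
        by (intro Bochner_Integration.integral_cong) (auto simp: dk abs_minus_commute)
      then show ?thesis by (simp add: Lp_norm_def)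
    qed
    ultimately show ?thesis using Lp by (simp add: Lp_converges_def Lp_uminus_iff)
  qed
  moreover have "F \<in> Lp p ?I" using M by (simp add: M1p_def)
  ultimately show ?thesis
    using k C1_homeomorphism_mem_Lp[OF C1_homeomorphism_reflect[OF f], of p] p
    by (auto simp: M1p_def Lp_uminus_iff intro!: exI[of _ k] exI[of _ "\<lambda>x. a + b - g x"])
qed

text \<open>The hypothesis \<open>f' \<in> L\<^sup>r\<close> enters twice: it makes \<open>f'\<close> integrable, and it dominates \<open>F\<close> in \<open>L\<^sup>r\<close>. The
  condition \<open>0 \<le> F \<le> f'\<close> does not mention the exponent \<open>p\<close>, hence membership for one exponent below \<open>1\<close>
  gives it for all.\<close>

lemma M1p_increasing_characterization:
  fixes p r a b :: real and f F :: "real \<Rightarrow> real"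
  assumes p: "0 < p" "p < 1" and ab: "a < b"
    and f: "C1_homeomorphism {a<..<b} f" "strict_mono_on {a<..<b} f"
    and nz: "\<And>x. x \<in> {a<..<b} \<Longrightarrow> deriv f x \<noteq> 0"
    and r: "1 < r" and dr: "deriv f \<in> Lp r {a<..<b}"
  shows "F \<in> Lp p {a<..<b} \<Longrightarrow> (f, F) \<in> M1p p {a<..<b} \<longleftrightarrow>
           (AE x in lebesgue_on {a<..<b}. 0 \<le> F x / deriv f x \<and> F x / deriv f x \<le> 1)"
    and "(f, F) \<in> M1p p {a<..<b} \<Longrightarrow> F \<in> Lp r {a<..<b}"
    and "(f, F) \<in> M1p p {a<..<b} \<Longrightarrow> 0 < q \<Longrightarrow> q < 1 \<Longrightarrow> (f, F) \<in> M1p q {a<..<b}"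
proof -
  let ?I = "{a<..<b}" and ?L = "lebesgue_on {a<..<b}"
  have pos: "0 < deriv f x" if "x \<in> ?I" for x
    using strict_mono_on_deriv_nonneg[OF f(2) C1_homeomorphism_has_derivative[OF f(1) that] that] nz[OF that]
    by simp
  have dint: "integrable ?L (deriv f)"
  proof (rule Bochner_Integration.integrable_bound)
    show "integrable ?L (\<lambda>x. 1 + \<bar>deriv f x\<bar> powr r)"
      using dr integrable_const_Ioo by (intro Bochner_Integration.integrable_add) (auto simp: Lp_def)
    show "deriv f \<in> borel_measurable ?L" using dr by (simp add: Lp_def)
    have "\<bar>t\<bar> \<le> 1 + \<bar>t\<bar> powr r" for t :: real
    proof (cases "\<bar>t\<bar> \<le> 1")
      case False
      then have "\<bar>t\<bar> powr 1 \<le> \<bar>t\<bar> powr r" using r by (intro powr_mono) auto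
      then show ?thesis by simp
    qed (simp add: add_increasing2)
    then show "AE x in ?L. norm (deriv f x) \<le> norm (1 + \<bar>deriv f x\<bar> powr r)"
      by (intro AE_I2) (simp add: add_nonneg_nonneg)
  qed
  have aeI: "AE x in ?L. x \<in> ?I" by (rule AE_I2) simp
  have ratio: "(AE x in ?L. 0 \<le> F x / deriv f x \<and> F x / deriv f x \<le> 1)
      \<longleftrightarrow> (AE x in ?L. 0 \<le> F x \<and> F x \<le> deriv f x)"
  proof (rule AE_cong)
    fix x assume "x \<in> space ?L"
    then have "0 < deriv f x" using pos by simp
    then show "0 \<le> F x / deriv f x \<and> F x / deriv f x \<le> 1 \<longleftrightarrow> 0 \<le> F x \<and> F x \<le> deriv f x"
      by (simp add: zero_le_divide_iff divide_le_eq_1 not_le)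
  qed
  have nec: "(f, F) \<in> M1p p ?I \<Longrightarrow> AE x in ?L. 0 \<le> F x \<and> F x \<le> deriv f x"
    by (rule M1p_imp_AE_between[OF p(1) ab f])
  have suff: "(f, F) \<in> M1p q ?I"
    if "0 < q" "q < 1" "F \<in> borel_measurable ?L" "AE x in ?L. 0 \<le> F x \<and> F x \<le> deriv f x" for q
    by (rule AE_between_imp_M1p[OF that(1,2) ab f pos dint that(3,4)])
  show "(f, F) \<in> M1p p ?I \<longleftrightarrow> (AE x in ?L. 0 \<le> F x / deriv f x \<and> F x / deriv f x \<le> 1)" if "F \<in> Lp p ?I"
  proof -
    have "F \<in> borel_measurable ?L" using that by (simp add: Lp_def)
    then show ?thesis unfolding ratio using nec suff[OF p] by blast
  qed
  assume M: "(f, F) \<in> M1p p ?I"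
  then have Fm: "F \<in> borel_measurable ?L" by (simp add: M1p_def Lp_def)
  show "0 < q \<Longrightarrow> q < 1 \<Longrightarrow> (f, F) \<in> M1p q ?I" by (rule suff[OF _ _ Fm nec[OF M]])
  have "integrable ?L (\<lambda>x. \<bar>F x\<bar> powr r)"
  proof (rule Bochner_Integration.integrable_bound)
    show "integrable ?L (\<lambda>x. \<bar>deriv f x\<bar> powr r)" using dr by (simp add: Lp_def)
    show "(\<lambda>x. \<bar>F x\<bar> powr r) \<in> borel_measurable ?L" using Fm by measurable
    show "AE x in ?L. norm (\<bar>F x\<bar> powr r) \<le> norm (\<bar>deriv f x\<bar> powr r)"
      using nec[OF M]
    proof eventually_elim
      case (elim x)
      then have "\<bar>F x\<bar> powr r \<le> \<bar>deriv f x\<bar> powr r" using r by (intro powr_mono2) auto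
      then show ?case by simp
    qed
  qed
  then show "F \<in> Lp r ?I" using Fm by (simp add: Lp_def)
qed

theorem theorem1:
  fixes p r a b :: real and I :: "real set" and f F :: "real \<Rightarrow> real"
  assumes "0 < p" and "p < 1"
    and "a < b" and "I = {a<..<b}"
    and "C1_homeomorphism I f"
    and "\<forall>x\<in>I. deriv f x \<noteq> 0"
    and "1 < r"
    and "deriv f \<in> Lp r I"
    and "deriv (inv_into I f) \<in> Lp r I"
  shows "(F \<in> Lp p I \<longrightarrow>
            ((f, F) \<in> M1p p I \<longleftrightarrow>
             (AE x in lebesgue_on I. 0 \<le> F x / deriv f x \<and> F x / deriv f x \<le> 1)))
       \<and> ((f, F) \<in> M1p p I \<longrightarrow>
            F \<in> Lp r I \<and> (\<forall>q. 0 < q \<and> q < 1 \<longrightarrow> (f, F) \<in> M1p q I))"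
proof -
  note I = assms(4)
  have f: "C1_homeomorphism {a<..<b} f" and nz: "\<And>x. x \<in> {a<..<b} \<Longrightarrow> deriv f x \<noteq> 0"
    and dr: "deriv f \<in> Lp r {a<..<b}"
    using assms by auto
  show ?thesis
  proof (cases "strict_mono_on {a<..<b} f")
    case True
    show ?thesis
      unfolding I using M1p_increasing_characterization[OF assms(1-3) f True nz assms(7) dr] by blast
  next
    case False
    then have anti: "strict_antimono_on {a<..<b} f" using C1_homeomorphism_monotone[OF f] by blast
    define k G where "k x = a + b - f x" and "G x = - F x" for x
    have k: "C1_homeomorphism {a<..<b} k" and dk: "\<And>x. x \<in> {a<..<b} \<Longrightarrow> deriv k x = - deriv f x"
      unfolding k_def[abs_def] by (rule C1_homeomorphism_reflect[OF f], rule deriv_reflect[OF f])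
    have kmono: "strict_mono_on {a<..<b} k" using anti by (auto simp: monotone_on_def k_def)
    have knz: "deriv k x \<noteq> 0" if "x \<in> {a<..<b}" for x using dk[OF that] nz[OF that] by simp
    have kr: "deriv k \<in> Lp r {a<..<b}"
      using dr Lp_cong[of "{a<..<b}" "deriv k" "\<lambda>x. - deriv f x" r, OF dk] by (simp add: Lp_uminus_iff)
    have M: "(k, G) \<in> M1p q {a<..<b} \<longleftrightarrow> (f, F) \<in> M1p q {a<..<b}" if "0 < q" for q
      using M1p_reflect[OF that f, of F] M1p_reflect[OF that k, of G]
      by (auto simp: k_def[abs_def] G_def[abs_def])
    have GL: "G \<in> Lp q {a<..<b} \<longleftrightarrow> F \<in> Lp q {a<..<b}" for q
      unfolding G_def[abs_def] by (rule Lp_uminus_iff)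
    have ratio: "(AE x in lebesgue_on {a<..<b}. 0 \<le> G x / deriv k x \<and> G x / deriv k x \<le> 1)
        \<longleftrightarrow> (AE x in lebesgue_on {a<..<b}. 0 \<le> F x / deriv f x \<and> F x / deriv f x \<le> 1)"
      by (rule AE_cong) (simp add: dk G_def)
    show ?thesis
      unfolding I
      using M1p_increasing_characterization[OF assms(1-3) k kmono knz assms(7) kr, of G]
      unfolding ratio GL M[OF assms(1)] using M by blast
  qed
qed

end
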